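(* There exist a probability space $(\Omega,\mathcal F,\mathbb P)$ endowed with an ergodic measurable group $(\tau_x)_{x\in\mathbb R}$ of measure-preserving transformations, and a stationary function $V_2:\mathbb R\times\Omega\to\mathbb R$ with $\mathbb E[V_2]=0$ such that $V_2(\cdot,\omega)\in\mathcal C^{1,1}(\mathbb R)$ almost surely in $\omega$, $\|V_2\|\le 2$, and, if $\delta(\omega)=\min\{|r| : r\in\mathbb R,\ |V_2(r,\omega)|\le 1\}$, then $\mathbb E[\delta]=\infty$. Moreover, if $\theta$ is the minimal time function corresponding to the vector field $V(x,\omega)=(0,V_2(x_1,\omega))$, $x=(x_1,x_2)\in\mathbb R^2$, and $\{e_1,e_2\}$ is the canonical basis of $\mathbb R^2$, then $$\text{either}\quad \mathbb E[\theta(0,e_2,\cdot)]=+\infty\quad\text{or}\quad \mathbb E[\theta(0,-e_2,\cdot)]=+\infty .$$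
   Context: The map $(x,\omega)\mapsto\tau_x\omega$ is measurable, each $\tau_x:\Omega\to\Omega$ is measure preserving, and $\tau_x\circ\tau_y=\tau_{x+y}$. Ergodic means: if $D\in\mathcal F$ satisfies $\tau_z(D)=D$ for every $z\in\mathbb R$, then $\mathbb P[D]\in\{0,1\}$. A measurable function $f$ on $\mathbb R\times\Omega$ is stationary if $f(y,\tau_z\omega)=f(y+z,\omega)$ for all $y,z\in\mathbb R$ and almost surely in $\omega$; then $\mathbb E[f]:=\mathbb E[f(x,\cdot)]$ does not depend on $x$, and $\|f\|$ denotes the sup norm of $f(\cdot,\omega)$, which is almost surely independent of $\omega$. $\mathcal C^{1,1}(\mathbb R)$ denotes bounded, continuously differentiable, Lipschitz continuous functions. Let $B$ be the closed unit ball of $\mathbb R^2$ and $\mathcal A$ the set of measurable maps $\alpha:\mathbb R\to B$ (controls). For $x\in\mathbb R^2$ and $\alpha\in\mathcal A$, $X^{x,0,\alpha,\omega}_t$ is the solution of $X'(s)=\alpha(s)+V(X(s),\omega)$ for a.e. $s$, $X(0)=x$. For $t\ge0$, $\mathcal R_t(x,\omega)=\{X^{x,0,\alpha,\omega}_t:\alpha\in\mathcal A\}$, and the minimal time is $\theta(x,y,\omega)=\min\{t\ge0:y\in\mathcal R_t(x,\omega)\}$, with value $+\infty$ if no such $t$ exists. *)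

theory Defs
  imports "HOL-Probability.Probability"
begin

definition measure_preserving_group :: "'w measure \<Rightarrow> (real \<Rightarrow> 'w \<Rightarrow> 'w) \<Rightarrow> bool" where
  "measure_preserving_group M \<tau> \<longleftrightarrow>
     (\<lambda>(x, \<omega>). \<tau> x \<omega>) \<in> measurable (borel \<Otimes>\<^sub>M M) M \<and>
     (\<forall>x. \<tau> x \<in> measurable M M \<and> distr M M (\<tau> x) = M) \<and>
     (\<forall>\<omega>\<in>space M. \<tau> 0 \<omega> = \<omega>) \<and>
     (\<forall>x y. \<forall>\<omega>\<in>space M. \<tau> x (\<tau> y \<omega>) = \<tau> (x + y) \<omega>)"

definition ergodic_group :: "'w measure \<Rightarrow> (real \<Rightarrow> 'w \<Rightarrow> 'w) \<Rightarrow> bool" where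
  "ergodic_group M \<tau> \<longleftrightarrow>
     measure_preserving_group M \<tau> \<and>
     (\<forall>D\<in>sets M. (\<forall>z. \<tau> z ` D = D) \<longrightarrow> measure M D \<in> {0, 1})"

definition stationary :: "'w measure \<Rightarrow> (real \<Rightarrow> 'w \<Rightarrow> 'w) \<Rightarrow> (real \<Rightarrow> 'w \<Rightarrow> real) \<Rightarrow> bool" where
  "stationary M \<tau> f \<longleftrightarrow>
     (\<lambda>(x, \<omega>). f x \<omega>) \<in> borel_measurable (borel \<Otimes>\<^sub>M M) \<and>
     (AE \<omega> in M. \<forall>y z. f y (\<tau> z \<omega>) = f (y + z) \<omega>)"

text \<open>Here \<open>C\<^sup>1\<^sup>,\<^sup>1\<close> asks for the function itself, not its derivative, to be Lipschitz.\<close>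

definition C11 :: "(real \<Rightarrow> real) set" where
  "C11 = {f. bounded (range f) \<and> f C1_differentiable_on UNIV \<and> (\<exists>L. L-lipschitz_on UNIV f)}"

definition sup_norm :: "(real \<Rightarrow> real) \<Rightarrow> ennreal" where
  "sup_norm f = (SUP r. ennreal \<bar>f r\<bar>)"

definition small_radii :: "(real \<Rightarrow> real) \<Rightarrow> real set" where
  "small_radii f = {\<bar>r\<bar> | r. \<bar>f r\<bar> \<le> 1}"

text \<open>This is the minimum of \<open>small_radii f\<close> whenever \<open>min_radius f \<in> small_radii f\<close>.\<close>

definition min_radius :: "(real \<Rightarrow> real) \<Rightarrow> real" where
  "min_radius f = Inf (small_radii f)"

definition absolutely_continuous_on_Icc :: "real \<Rightarrow> real \<Rightarrow> (real \<Rightarrow> 'a::real_normed_vector) \<Rightarrow> bool" where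
  "absolutely_continuous_on_Icc a b f \<longleftrightarrow>
     (\<forall>\<epsilon>>0. \<exists>\<delta>>0. \<forall>D :: (real \<times> real) set.
        finite D \<and> (\<forall>(u, v)\<in>D. a \<le> u \<and> u \<le> v \<and> v \<le> b) \<and>
        pairwise (\<lambda>p q. disjnt {fst p<..<snd p} {fst q<..<snd q}) D \<and>
        (\<Sum>(u, v)\<in>D. v - u) < \<delta>
        \<longrightarrow> (\<Sum>(u, v)\<in>D. norm (f v - f u)) < \<epsilon>)"

definition controls :: "(real \<Rightarrow> real^2) set" where
  "controls = {\<alpha>. \<alpha> \<in> borel_measurable lebesgue \<and> (\<forall>s. \<alpha> s \<in> cball 0 1)}"

text \<open>Solutions of the controlled equation are understood in the sense of Caratheodory:
  locally absolutely continuous, satisfying the equation almost everywhere.\<close>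

definition trajectory :: "(real^2 \<Rightarrow> real^2) \<Rightarrow> real^2 \<Rightarrow> (real \<Rightarrow> real^2) \<Rightarrow> (real \<Rightarrow> real^2) \<Rightarrow> bool" where
  "trajectory V x \<alpha> X \<longleftrightarrow>
     X 0 = x \<and>
     (\<forall>a b. absolutely_continuous_on_Icc a b X) \<and>
     (AE s in lebesgue. (X has_vector_derivative (\<alpha> s + V (X s))) (at s))"

definition reachable :: "(real^2 \<Rightarrow> real^2) \<Rightarrow> real \<Rightarrow> real^2 \<Rightarrow> (real^2) set" where
  "reachable V t x = {X t | X \<alpha>. \<alpha> \<in> controls \<and> trajectory V x \<alpha> X}"

text \<open>The infimum of the empty set in \<^typ>\<open>ennreal\<close> is \<open>\<infinity>\<close>; if the set of times has a
  minimum, the infimum is that minimum.\<close>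

definition min_time :: "(real^2 \<Rightarrow> real^2) \<Rightarrow> real^2 \<Rightarrow> real^2 \<Rightarrow> ennreal" where
  "min_time V x y = Inf {ennreal t | t. t \<ge> 0 \<and> y \<in> reachable V t x}"

definition shear_field :: "(real \<Rightarrow> 'w \<Rightarrow> real) \<Rightarrow> 'w \<Rightarrow> real^2 \<Rightarrow> real^2" where
  "shear_field V\<^sub>2 \<omega> x = vector [0, V\<^sub>2 (x $ 1) \<omega>]"

end

theory Submission
  imports Defs
begin

text \<open>The probability space carries the suspension flow over the rotation of the circle by
  \<open>\<surd>2\<close>: a point \<open>(a, c)\<close> of the unit square moves at unit speed in \<open>a\<close>, and whenever \<open>a\<close> passes an
  integer, \<open>c\<close> is rotated by \<open>\<surd>2\<close>. An invariant set is a product of \<open>[0, 1)\<close> with a rotation-invariant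
  set of the circle, so ergodicity of the flow is the zero-one law for the rotation
  (\<open>circle_zero_one\<close>). The latter holds because \<open>(\<surd>2 - 1)\<^sup>k\<close> is, for every \<open>k\<close>, a period of the lifted
  invariant set; arbitrarily small periods force it to have the same density in all intervals
  (\<open>periodic_density\<close>), and a set whose density is the same positive number everywhere has full measure.

  The speed along an orbit interpolates, in a continuously differentiable way, the values at the
  integers, which depend only on whether the rotated point \<open>c + n\<surd>2\<close> lies in a set \<open>spikes\<close> of the
  circle: the speed is \<open>2\<close> in \<open>spikes\<close> and a value in \<open>[-1, 0]\<close> outside, chosen to give mean zero. That
  value is possible because \<open>spikes\<close> has measure at most \<open>1/6\<close>. On the other hand, \<open>spikes\<close>
  contains, for each \<open>k\<close>, a stretch of the order of \<open>4\<^sup>k\<close> consecutive rotates of an arc whose length is of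
  order \<open>8\<^sup>-\<^sup>k\<close>. Half of these rotates lie at least \<open>4\<^sup>k\<close> steps away from both ends of this stretch, so
  there the distance \<open>\<delta>\<close> to slow speeds is at least \<open>4\<^sup>k - 1\<close>. As \<open>\<surd>2\<close> is badly approximable
  (\<open>sqrt2_badly_approximable\<close>), these rotates are disjoint and their union has measure of order
  \<open>2\<^sup>-\<^sup>k\<close>. This is summable in \<open>k\<close>, but its product with \<open>4\<^sup>k\<close> is unbounded, hence \<open>\<delta>\<close> has infinite
  expectation (\<open>nn_integral_min_radius\<close>).

  Finally, a controlled trajectory from the origin has horizontal speed at most \<open>1\<close>, so until time \<open>\<delta>\<close>
  it sees only vertical drift greater than \<open>1\<close>, against which no control moves downwards. Hence
  \<open>-e\<^sub>2\<close> is not reached before time \<open>\<delta>\<close> (\<open>min_time_shear_ge\<close>), and the second alternative of the theorem holds.\<close>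

section \<open>Speed limits for absolutely continuous curves and the minimal time\<close>

lemma absolutely_continuous_on_Icc_dominated:
  fixes f :: "real \<Rightarrow> 'a::real_normed_vector" and g :: "real \<Rightarrow> 'b::real_normed_vector"
  assumes f: "absolutely_continuous_on_Icc a b f"
    and le: "\<And>u v. norm (g v - g u) \<le> norm (f v - f u)"
  shows "absolutely_continuous_on_Icc a b g"
  unfolding absolutely_continuous_on_Icc_def
proof (intro allI impI)
  fix \<epsilon> :: real assume "\<epsilon> > 0"
  then obtain \<delta> where \<delta>: "\<delta> > 0" and D: "\<And>D :: (real \<times> real) set.
        finite D \<and> (\<forall>(u, v)\<in>D. a \<le> u \<and> u \<le> v \<and> v \<le> b) \<and>
        pairwise (\<lambda>p q. disjnt {fst p<..<snd p} {fst q<..<snd q}) D \<and>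
        (\<Sum>(u, v)\<in>D. v - u) < \<delta> \<Longrightarrow> (\<Sum>(u, v)\<in>D. norm (f v - f u)) < \<epsilon>"
    using f unfolding absolutely_continuous_on_Icc_def by meson
  have *: "(\<Sum>(u, v)\<in>D. norm (g v - g u)) \<le> (\<Sum>(u, v)\<in>D. norm (f v - f u))" for D
    by (intro sum_mono) (auto simp: le)
  show "\<exists>\<delta>>0. \<forall>D. finite D \<and> (\<forall>(u, v)\<in>D. a \<le> u \<and> u \<le> v \<and> v \<le> b) \<and>
            pairwise (\<lambda>p q. disjnt {fst p<..<snd p} {fst q<..<snd q}) D \<and>
            (\<Sum>(u, v)\<in>D. v - u) < \<delta> \<longrightarrow> (\<Sum>(u, v)\<in>D. norm (g v - g u)) < \<epsilon>"
    using \<delta> D * by (meson le_less_trans)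
qed

text \<open>The derivative may fail to exist, or exceed \<open>K\<close>, on a null set \<open>N\<close>. Cover \<open>N\<close> by an open set \<open>U\<close> of
  small measure and take a tagged partition of \<open>[a, b]\<close> whose cells with tag in \<open>N\<close> lie in \<open>U\<close>, while the
  other cells are so short that the derivative at the tag controls the increment. The cells of the
  first kind have small total length, so absolute continuity makes their total increment small.\<close>

lemma absolutely_continuous_growth_bound:
  fixes f :: "real \<Rightarrow> real"
  assumes ab: "a \<le> b" and K: "0 \<le> K" and ac: "absolutely_continuous_on_Icc a b f"
    and deriv: "AE s in lebesgue. a \<le> s \<and> s \<le> b \<longrightarrow>
                  (\<exists>D\<le>K. (f has_vector_derivative D) (at s))"
  shows "f b - f a \<le> K * (b - a)"
proof -
  have approx: "f b - f a \<le> K * (b - a) + \<epsilon> * (b - a) + \<epsilon>" if \<epsilon>: "\<epsilon> > 0" for \<epsilon>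
  proof -
    obtain \<delta> where \<delta>: "\<delta> > 0" and D: "\<And>D :: (real \<times> real) set.
        finite D \<Longrightarrow> (\<forall>(u, v)\<in>D. a \<le> u \<and> u \<le> v \<and> v \<le> b) \<Longrightarrow>
        pairwise (\<lambda>p q. disjnt {fst p<..<snd p} {fst q<..<snd q}) D \<Longrightarrow>
        (\<Sum>(u, v)\<in>D. v - u) < \<delta> \<Longrightarrow> (\<Sum>(u, v)\<in>D. norm (f v - f u)) < \<epsilon>"
      using ac \<epsilon> unfolding absolutely_continuous_on_Icc_def by meson
    obtain N where N: "{s. \<not> (a \<le> s \<and> s \<le> b \<longrightarrow> (\<exists>D\<le>K. (f has_vector_derivative D) (at s)))} \<subseteq> N"
        and Nnull: "emeasure lebesgue N = 0" and Nsets: "N \<in> sets lebesgue"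
      using deriv by (auto elim!: AE_E)
    obtain U where U: "open U" "N \<subseteq> U" and UN: "emeasure lebesgue (U - N) < ennreal \<delta>"
      using sets_lebesgue_outer_open[OF Nsets \<delta>] by metis
    have Umeas: "emeasure lebesgue U < ennreal \<delta>"
    proof -
      have "emeasure lebesgue U \<le> emeasure lebesgue (U - N) + emeasure lebesgue N"
        using U Nsets by (intro order.trans[OF emeasure_mono emeasure_subadditive]) auto
      then show ?thesis using UN Nnull by simp
    qed
    have "\<exists>r>0. \<forall>u v. u \<le> s \<and> s \<le> v \<and> {u..v} \<subseteq> ball s r \<longrightarrow> f v - f u \<le> (K + \<epsilon>) * (v - u)"
      if "s \<notin> N" "a \<le> s" "s \<le> b" for s
    proof -
      have "\<exists>D\<le>K. (f has_vector_derivative D) (at s)"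
        using contra_subsetD[OF N \<open>s \<notin> N\<close>] that(2,3) by simp
      then obtain D where DK: "D \<le> K" and "(f has_vector_derivative D) (at s)" by metis
      then obtain r where "r > 0" and r: "\<And>y. norm (y - s) < r \<Longrightarrow>
            norm (f y - f s - (y - s) *\<^sub>R D) \<le> \<epsilon> * norm (y - s)"
        unfolding has_vector_derivative_def has_derivative_at_alt using \<epsilon> by blast
      have "f v - f u \<le> (K + \<epsilon>) * (v - u)"
        if "u \<le> s" "s \<le> v" "{u..v} \<subseteq> ball s r" for u v
      proof -
        have "u \<in> {u..v}" "v \<in> {u..v}" using that by auto
        then have "u \<in> ball s r" "v \<in> ball s r" using subsetD[OF that(3)] by metis+
        then have "\<bar>f v - f s - (v - s) * D\<bar> \<le> \<epsilon> * \<bar>v - s\<bar>" "\<bar>f u - f s - (u - s) * D\<bar> \<le> \<epsilon> * \<bar>u - s\<bar>"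
          using r[of v] r[of u] by (auto simp: dist_real_def abs_minus_commute)
        then have "f v - f u \<le> (v - u) * D + \<epsilon> * (v - u)"
          using that by (simp add: abs_if algebra_simps split: if_splits)
        also have "(v - u) * D \<le> (v - u) * K"
          using that DK by (intro mult_left_mono) auto
        finally show ?thesis by (simp add: algebra_simps)
      qed
      then show ?thesis using \<open>r > 0\<close> by blast
    qed
    then obtain r where r: "\<And>s. \<lbrakk>s \<notin> N; a \<le> s; s \<le> b\<rbrakk> \<Longrightarrow> r s > 0"
      "\<And>s u v. \<lbrakk>s \<notin> N; a \<le> s; s \<le> b; u \<le> s; s \<le> v; {u..v} \<subseteq> ball s (r s)\<rbrakk>
          \<Longrightarrow> f v - f u \<le> (K + \<epsilon>) * (v - u)"
      by metis
    \<comment> \<open>Cells tagged in the null set are kept inside \<open>U\<close>; outside \<open>[a, b]\<close> any radius makes \<open>\<gamma>\<close> a gauge.\<close>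
    define \<gamma> where "\<gamma> s = (if s \<in> N then U else ball s (if a \<le> s \<and> s \<le> b then r s else 1))" for s
    have "gauge \<gamma>"
      using U r(1) by (auto simp: gauge_def \<gamma>_def)
    then obtain p where p: "p tagged_division_of {a..b}" and fine: "\<gamma> fine p"
      by (rule fine_division_exists_real)
    have fin: "finite p" using p by blast
    have cell: "{Inf k..Sup k} = k \<and> a \<le> Inf k \<and> Inf k \<le> Sup k \<and> Sup k \<le> b \<and>
        Inf k \<le> s \<and> s \<le> Sup k \<and> k \<subseteq> \<gamma> s"
      if sk: "(s, k) \<in> p" for s k
    proof -
      obtain u v where uv: "k = cbox u v" using tagged_division_ofD(4)[OF p sk] by blast
      have "s \<in> k" "k \<subseteq> {a..b}"
        using tagged_division_ofD(2,3)[OF p sk] by auto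
      moreover have "k \<subseteq> \<gamma> s" using fine sk by (auto simp: fine_def)
      ultimately show ?thesis using uv by auto
    qed
    define bad where "bad = {t \<in> p. fst t \<in> N}"
    define h where "h = (\<lambda>(s::real, k::real set). (Inf k, Sup k))"
    have badp: "bad \<subseteq> p" and finb: "finite bad" using fin by (auto simp: bad_def)
    have disj: "{Inf k<..<Sup k} \<inter> {Inf k'<..<Sup k'} = {}"
      if "(s, k) \<in> p" "(s', k') \<in> p" "(s, k) \<noteq> (s', k')" for s k s' k'
    proof -
      have "interior k \<inter> interior k' = {}"
        by (rule tagged_division_ofD(5)[OF p that])
      moreover have "{Inf k<..<Sup k} \<subseteq> interior k" "{Inf k'<..<Sup k'} \<subseteq> interior k'"
        using cell[OF that(1)] cell[OF that(2)] by (metis interior_atLeastAtMost_real order_refl)+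
      ultimately show ?thesis by blast
    qed
    have pw: "pairwise (\<lambda>p q. disjnt {fst p<..<snd p} {fst q<..<snd q}) (h ` bad)"
      using disj badp unfolding pairwise_def disjnt_def h_def by fastforce
    have rng: "\<forall>(u, v)\<in>h ` bad. a \<le> u \<and> u \<le> v \<and> v \<le> b"
    proof clarify
      fix u v s k assume "(u, v) = h (s, k)" "(s, k) \<in> bad"
      then show "a \<le> u \<and> u \<le> v \<and> v \<le> b"
        using cell[OF subsetD[OF badp]] by (auto simp: h_def)
    qed
    have short: "(\<Sum>(u, v)\<in>h ` bad. v - u) < \<delta>"
    proof -
      have "ennreal (\<Sum>(u, v)\<in>h ` bad. v - u) = (\<Sum>q\<in>h ` bad. emeasure lborel {fst q<..<snd q})"
        using rng by (subst sum_ennreal[symmetric]) (auto intro!: sum.cong)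
      also have "\<dots> = emeasure lborel (\<Union>q\<in>h ` bad. {fst q<..<snd q})"
        using pw finb by (intro sum_emeasure)
          (auto simp: disjoint_family_on_def pairwise_def disjnt_def)
      also have "\<dots> \<le> emeasure lborel U"
      proof (rule emeasure_mono)
        show "(\<Union>q\<in>h ` bad. {fst q<..<snd q}) \<subseteq> U"
        proof
          fix x assume "x \<in> (\<Union>q\<in>h ` bad. {fst q<..<snd q})"
          then obtain s k where sk: "(s, k) \<in> bad" and "x \<in> {Inf k<..<Sup k}"
            by (auto simp: h_def)
          then have "x \<in> {Inf k..Sup k}" by simp
          then have "x \<in> \<gamma> s" using cell[OF subsetD[OF badp sk]] by auto
          then show "x \<in> U" using sk by (simp add: bad_def \<gamma>_def)
        qed
      qed (use U in auto)
      also have "\<dots> < ennreal \<delta>" using Umeas U by simp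
      finally have "ennreal (\<Sum>(u, v)\<in>h ` bad. v - u) < ennreal \<delta>" .
      moreover have "0 \<le> (\<Sum>(u, v)\<in>h ` bad. v - u)"
        using rng by (intro sum_nonneg) auto
      ultimately show ?thesis by (simp only: ennreal_less_iff)
    qed
    have "(\<Sum>t\<in>bad. norm (f (Sup (snd t)) - f (Inf (snd t)))) = (\<Sum>(u, v)\<in>h ` bad. norm (f v - f u))"
    proof (subst sum.reindex_nontrivial)
      fix t t' assume t: "t \<in> bad" "t' \<in> bad" "t \<noteq> t'" "h t = h t'"
      then have "{fst (h t)<..<snd (h t)} = {}"
        using disj[of "fst t" "snd t" "fst t'" "snd t'"] badp by (auto simp: h_def split: prod.splits)
      moreover have "fst (h t) \<le> snd (h t)" using rng t(1) by (auto split: prod.splits)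
      ultimately have "fst (h t) = snd (h t)" by simp
      then show "(case h t of (u, v) \<Rightarrow> norm (f v - f u)) = 0" by (auto split: prod.splits)
    qed (auto simp: finb h_def split: prod.splits intro!: sum.cong)
    also have "\<dots> < \<epsilon>" using D[OF _ rng pw short] finb by blast
    finally have badsum: "(\<Sum>t\<in>bad. norm (f (Sup (snd t)) - f (Inf (snd t)))) < \<epsilon>" .
    have "f b - f a = (\<Sum>(s, k)\<in>p. f (Sup k) - f (Inf k))"
      using additive_tagged_division_1[OF ab p, of f] by simp
    also have "\<dots> \<le> (\<Sum>(s, k)\<in>p. (K + \<epsilon>) * (Sup k - Inf k)
         + (if (s, k) \<in> bad then norm (f (Sup k) - f (Inf k)) - (K + \<epsilon>) * (Sup k - Inf k) else 0))"
    proof (intro sum_mono, clarify)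
      fix s k assume sk: "(s, k) \<in> p"
      note c = cell[OF sk]
      show "f (Sup k) - f (Inf k) \<le> (K + \<epsilon>) * (Sup k - Inf k)
         + (if (s, k) \<in> bad then norm (f (Sup k) - f (Inf k)) - (K + \<epsilon>) * (Sup k - Inf k) else 0)"
        using c sk r(2)[of s "Inf k" "Sup k"] by (auto simp: bad_def \<gamma>_def)
    qed
    also have "\<dots> = (K + \<epsilon>) * (b - a)
        + (\<Sum>t\<in>bad. norm (f (Sup (snd t)) - f (Inf (snd t))) - (K + \<epsilon>) * (Sup (snd t) - Inf (snd t)))"
    proof -
      have "(\<Sum>(s, k)\<in>p. Sup k - Inf k) = b - a"
        using additive_tagged_division_1[OF ab p, of "\<lambda>x. x"] by simp
      moreover have "(\<Sum>t\<in>p. if t \<in> bad then g t else 0) = sum g bad" for g :: "_ \<Rightarrow> real"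
        using sum.inter_restrict[OF fin, of g bad] badp by (simp add: Int_absorb1)
      ultimately show ?thesis
        by (simp add: sum.distrib split_def flip: sum_distrib_left)
    qed
    also have "\<dots> \<le> (K + \<epsilon>) * (b - a) + \<epsilon>"
    proof -
      have "(\<Sum>t\<in>bad. norm (f (Sup (snd t)) - f (Inf (snd t))) - (K + \<epsilon>) * (Sup (snd t) - Inf (snd t)))
          \<le> (\<Sum>t\<in>bad. norm (f (Sup (snd t)) - f (Inf (snd t))))"
      proof (rule sum_mono)
        fix t assume "t \<in> bad"
        then have "Inf (snd t) \<le> Sup (snd t)"
          using cell[of "fst t" "snd t"] subsetD[OF badp] by auto
        then show "norm (f (Sup (snd t)) - f (Inf (snd t))) - (K + \<epsilon>) * (Sup (snd t) - Inf (snd t))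
            \<le> norm (f (Sup (snd t)) - f (Inf (snd t)))"
          using K \<epsilon> by simp
      qed
      then show ?thesis using badsum by simp
    qed
    finally show ?thesis by (simp add: algebra_simps)
  qed
  have "f b - f a - K * (b - a) \<le> 0"
  proof (rule field_le_epsilon)
    fix e :: real assume "e > 0"
    define \<epsilon> where "\<epsilon> = e / (b - a + 1)"
    have "\<epsilon> > 0" and "\<epsilon> * (b - a + 1) = e"
      using \<open>e > 0\<close> ab by (simp_all add: \<epsilon>_def)
    then have "\<epsilon> > 0" and "\<epsilon> * (b - a) + \<epsilon> = e"
      by (simp_all only: distrib_left mult_1_right)
    then show "f b - f a - K * (b - a) \<le> 0 + e"
      using approx[of \<epsilon>] by simp
  qed
  then show ?thesis by simp
qed

text \<open>The horizontal coordinate of a trajectory stays in \<open>[-t, t]\<close> up to time \<open>t\<close>. Before time \<open>d\<close> the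
  drift therefore exceeds \<open>1\<close>, the maximal speed of the control, and the vertical coordinate cannot
  decrease.\<close>

lemma min_time_shear_ge:
  fixes V :: "real \<Rightarrow> 'w \<Rightarrow> real"
  assumes ge: "\<And>r. \<bar>r\<bar> < d \<Longrightarrow> 1 < V r \<omega>"
  shows "ennreal d \<le> min_time (shear_field V \<omega>) 0 (- axis 2 1)"
  unfolding min_time_def
proof (rule Inf_greatest, clarify)
  fix t :: real assume t: "0 \<le> t" and "- axis 2 1 \<in> reachable (shear_field V \<omega>) t 0"
  then obtain X \<alpha> where X: "X t = - axis 2 1" and \<alpha>: "\<alpha> \<in> controls"
    and tr: "trajectory (shear_field V \<omega>) 0 \<alpha> X"
    unfolding reachable_def by auto
  have X0: "X 0 = 0" and ac: "\<And>a b. absolutely_continuous_on_Icc a b X"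
    and ode: "AE s in lebesgue. (X has_vector_derivative (\<alpha> s + shear_field V \<omega> (X s))) (at s)"
    using tr unfolding trajectory_def by auto
  have \<alpha>le: "\<bar>\<alpha> s $ i\<bar> \<le> 1" for s i
    using \<alpha> component_le_norm_cart[of "\<alpha> s" i] order_trans unfolding controls_def by fastforce
  have coord: "absolutely_continuous_on_Icc a b (\<lambda>s. c * X s $ i)" if "\<bar>c\<bar> = 1" for a b i c
    using that component_le_norm_cart
    by (intro absolutely_continuous_on_Icc_dominated[OF ac])
       (auto simp: abs_mult right_diff_distrib[symmetric] vector_minus_component[symmetric]
             simp del: vector_minus_component)
  have deriv: "((\<lambda>s. c * X s $ i) has_vector_derivative c * (\<alpha> s + shear_field V \<omega> (X s)) $ i) (at s)"
    if "(X has_vector_derivative (\<alpha> s + shear_field V \<omega> (X s))) (at s)" for s i c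
    using bounded_linear.has_vector_derivative[OF _ that, of "\<lambda>x. c * x $ i"]
    by (simp add: bounded_linear_const_mult bounded_linear_vec_nth)
  have first: "\<bar>X s $ 1\<bar> \<le> s" if "0 \<le> s" for s
  proof -
    have "c * X s $ 1 - c * X 0 $ 1 \<le> 1 * (s - 0)" if "\<bar>c\<bar> = 1" for c
    proof (rule absolutely_continuous_growth_bound[OF \<open>0 \<le> s\<close> _ coord[OF that]])
      show "AE r in lebesgue. 0 \<le> r \<and> r \<le> s \<longrightarrow>
              (\<exists>D\<le>1. ((\<lambda>s. c * X s $ 1) has_vector_derivative D) (at r))"
        using ode
      proof eventually_elim
        case (elim r)
        moreover have "c * (\<alpha> r + shear_field V \<omega> (X r)) $ 1 \<le> 1"
          using \<alpha>le[of r 1] that by (auto simp: shear_field_def abs_if split: if_splits)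
        ultimately show ?case using deriv by blast
      qed
    qed simp
    from this[of 1] this[of "-1"] show ?thesis by (simp add: X0)
  qed
  have "d \<le> t"
  proof (rule ccontr)
    assume "\<not> d \<le> t"
    have "- 1 * X t $ 2 - - 1 * X 0 $ 2 \<le> 0 * (t - 0)"
    proof (rule absolutely_continuous_growth_bound[OF t _ coord])
      show "AE r in lebesgue. 0 \<le> r \<and> r \<le> t \<longrightarrow>
              (\<exists>D\<le>0. ((\<lambda>s. - 1 * X s $ 2) has_vector_derivative D) (at r))"
        using ode
      proof eventually_elim
        case (elim r)
        have "- 1 * (\<alpha> r + shear_field V \<omega> (X r)) $ 2 \<le> 0" if r: "0 \<le> r" "r \<le> t"
        proof -
          have "1 < V (X r $ 1) \<omega>"
            using first[OF r(1)] r \<open>\<not> d \<le> t\<close> by (intro ge) auto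
          then show ?thesis
            using \<alpha>le[of r 2] by (auto simp: shear_field_def abs_if split: if_splits)
        qed
        then show ?case using deriv[OF elim, of "-1" 2] by blast
      qed
    qed auto
    then show False by (simp add: X X0 axis_def)
  qed
  then show "ennreal d \<le> ennreal t" by (rule ennreal_leI)
qed

section \<open>Sets of reals with periods 1 and the square root of 2\<close>

lemma emeasure_lborel_vimage_plus:
  fixes A :: "real set"
  assumes "A \<in> sets borel"
  shows "emeasure lborel ((+) t -` A) = emeasure lborel A"
proof -
  have "emeasure lborel A = emeasure (distr lborel borel ((+) t)) A"
    by (simp add: lborel_distr_plus)
  also have "\<dots> = emeasure lborel ((+) t -` A)"
    using assms by (subst emeasure_distr) auto
  finally show ?thesis by simp
qed

lemma emeasure_lborel_split:
  fixes P :: "real set"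
  assumes "P \<in> sets borel" "a \<le> b" "b \<le> c"
  shows "emeasure lborel (P \<inter> {a..<c}) = emeasure lborel (P \<inter> {a..<b}) + emeasure lborel (P \<inter> {b..<c})"
  using assms by (subst plus_emeasure) (auto intro!: arg_cong2[where f = emeasure])

definition is_period :: "real set \<Rightarrow> real \<Rightarrow> bool" where
  "is_period P d \<longleftrightarrow> (\<forall>x. d + x \<in> P \<longleftrightarrow> x \<in> P)"

lemma is_period_diff:
  assumes "is_period P c" "is_period P d"
  shows "is_period P (c - d)"
  unfolding is_period_def
proof
  fix x
  have "c - d + x \<in> P \<longleftrightarrow> d + (c - d + x) \<in> P"
    using assms(2) unfolding is_period_def by blast
  also have "d + (c - d + x) = c + x" by simp
  finally show "c - d + x \<in> P \<longleftrightarrow> x \<in> P"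
    using assms(1) unfolding is_period_def by blast
qed

lemma is_period_of_nat_mult:
  assumes "is_period P d"
  shows "is_period P (of_nat n * d)"
proof (induction n)
  case (Suc n)
  have "is_period P (of_nat n * d - (0 - d))"
    by (intro is_period_diff Suc assms) (simp add: is_period_def)
  then show ?case by (simp add: algebra_simps)
qed (simp add: is_period_def)

lemma is_period_of_int_mult:
  assumes "is_period P d"
  shows "is_period P (of_int n * d)"
proof (cases n rule: int_diff_cases)
  case (diff k l)
  then show ?thesis
    using is_period_diff[OF is_period_of_nat_mult is_period_of_nat_mult, OF assms assms, of k l]
    by (simp add: left_diff_distrib)
qed

lemma emeasure_period_shift:
  fixes P :: "real set"
  assumes P: "P \<in> sets borel" and d: "is_period P d"
  shows "emeasure lborel (P \<inter> {d + a..<d + b}) = emeasure lborel (P \<inter> {a..<b})"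
proof -
  have "(+) d -` (P \<inter> {d + a..<d + b}) = P \<inter> {a..<b}"
    using d by (auto simp: is_period_def)
  then show ?thesis
    using emeasure_lborel_vimage_plus[of "P \<inter> {d + a..<d + b}" d] P by simp
qed

text \<open>Move the left end point into \<open>[0, d)\<close> by a multiple of the period; the part of the interval that
  then sticks out beyond \<open>d\<close> is a translate by \<open>d\<close> of the part that is missing at the left.\<close>

lemma emeasure_period_interval:
  fixes P :: "real set"
  assumes P: "P \<in> sets borel" and d: "is_period P d" "0 < d"
  shows "emeasure lborel (P \<inter> {l..<l + d}) = emeasure lborel (P \<inter> {0..<d})"
proof -
  define n where "n = \<lfloor>l / d\<rfloor>"
  define r where "r = l - of_int n * d"
  have r: "0 \<le> r" "r \<le> d"
    using floor_divide_lower[OF d(2), of l] floor_divide_upper[OF d(2), of l]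
    by (simp_all add: r_def n_def algebra_simps)
  have "emeasure lborel (P \<inter> {l..<l + d}) = emeasure lborel (P \<inter> {r..<r + d})"
    using emeasure_period_shift[OF P is_period_of_int_mult[OF d(1), of n], of r "r + d"]
    by (simp add: r_def algebra_simps)
  also have "\<dots> = emeasure lborel (P \<inter> {r..<d}) + emeasure lborel (P \<inter> {d + 0..<d + r})"
    using emeasure_lborel_split[OF P, of r d "r + d"] r by (simp add: add.commute)
  also have "emeasure lborel (P \<inter> {d + 0..<d + r}) = emeasure lborel (P \<inter> {0..<r})"
    by (rule emeasure_period_shift[OF P d(1)])
  also have "emeasure lborel (P \<inter> {r..<d}) + \<dots> = emeasure lborel (P \<inter> {0..<d})"
    using emeasure_lborel_split[OF P, of 0 r d] r by (simp add: add.commute)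
  finally show ?thesis .
qed

lemma emeasure_Int_Ico_finite: "emeasure lborel (P \<inter> {a..<b :: real}) \<noteq> \<infinity>"
proof -
  have "emeasure lborel (P \<inter> {a..<b}) \<le> emeasure lborel {a..<b}"
    by (rule emeasure_mono) auto
  also have "\<dots> < \<infinity>" by (cases "a \<le> b") auto
  finally show ?thesis by simp
qed

lemma measure_lborel_split:
  fixes P :: "real set"
  assumes "P \<in> sets borel" "a \<le> b" "b \<le> c"
  shows "measure lborel (P \<inter> {a..<c}) = measure lborel (P \<inter> {a..<b}) + measure lborel (P \<inter> {b..<c})"
  using emeasure_lborel_split[OF assms] emeasure_Int_Ico_finite[of P]
  by (simp add: measure_def enn2real_plus less_top)

lemma measure_Int_Ico_le:
  fixes P :: "real set"
  assumes "a \<le> b"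
  shows "measure lborel (P \<inter> {a..<b}) \<le> b - a"
proof -
  have "emeasure lborel (P \<inter> {a..<b}) \<le> emeasure lborel {a..<b}"
    by (rule emeasure_mono) auto
  then have "emeasure lborel (P \<inter> {a..<b}) \<le> ennreal (b - a)" using assms by simp
  then show ?thesis using assms by (simp add: measure_def enn2real_leI)
qed

text \<open>Up to a remainder shorter than one period, the interval consists of \<open>\<lfloor>x / d\<rfloor>\<close> full periods, and
  rounding \<open>x / d\<close> to an integer costs at most one more period.\<close>

lemma measure_period_approx:
  fixes P :: "real set"
  assumes P: "P \<in> sets borel" and d: "is_period P d" "0 < d" and x: "0 \<le> x"
  shows "\<bar>measure lborel (P \<inter> {l..<l + x}) - x / d * measure lborel (P \<inter> {0..<d})\<bar> \<le> 2 * d"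
proof -
  define g where "g = measure lborel (P \<inter> {0..<d})"
  have g: "0 \<le> g" "g \<le> d"
    using measure_Int_Ico_le[of 0 d P] d(2) by (auto simp: g_def)
  have multiples: "measure lborel (P \<inter> {l..<l + of_nat n * d}) = of_nat n * g" for n
  proof (induction n)
    case (Suc n)
    have "measure lborel (P \<inter> {l..<l + of_nat (Suc n) * d})
        = of_nat n * g + measure lborel (P \<inter> {l + of_nat n * d..<(l + of_nat n * d) + d})"
      using measure_lborel_split[OF P, of l "l + of_nat n * d" "l + of_nat (Suc n) * d"] d(2) Suc
      by (simp add: algebra_simps)
    also have "measure lborel (P \<inter> {l + of_nat n * d..<(l + of_nat n * d) + d}) = g"
      using emeasure_period_interval[OF P d] by (simp add: measure_def g_def)
    finally show ?case by (simp add: algebra_simps)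
  qed simp
  define n where "n = nat \<lfloor>x / d\<rfloor>"
  have n: "of_nat n * d \<le> x" "x < of_nat n * d + d"
    using floor_divide_lower[OF d(2), of x] floor_divide_upper[OF d(2), of x] x d(2)
    by (simp_all add: n_def algebra_simps)
  define e where "e = measure lborel (P \<inter> {l + of_nat n * d..<l + x})"
  have "measure lborel (P \<inter> {l..<l + x}) = of_nat n * g + e"
    using measure_lborel_split[OF P, of l "l + of_nat n * d" "l + x"] n d(2)
    by (simp add: multiples e_def)
  moreover have "0 \<le> e" "e \<le> d"
    using measure_Int_Ico_le[of "l + of_nat n * d" "l + x" P] n by (auto simp: e_def)
  moreover define r where "r = (x - of_nat n * d) / d * g"
  have "x / d * g = of_nat n * g + r"
    using d(2) by (simp add: r_def field_simps)
  moreover have "0 \<le> r"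
    using n d(2) g by (simp add: r_def)
  moreover have "r \<le> 1 * d"
    unfolding r_def using n d(2) g by (intro mult_mono) auto
  ultimately show ?thesis by (simp add: g_def)
qed

text \<open>The periods form a group, and \<open>\<int>[\<surd>2]\<close> is closed under multiplication by \<open>\<surd>2 - 1\<close>. The second
  conjunct makes the induction work.\<close>

lemma is_period_sqrt2_power:
  assumes "is_period P 1" "is_period P (sqrt 2)"
  shows "is_period P ((sqrt 2 - 1) ^ k) \<and> is_period P (sqrt 2 * (sqrt 2 - 1) ^ k)"
proof (induction k)
  case (Suc k)
  let ?q = "(sqrt 2 - 1) ^ k :: real"
  have "is_period P (sqrt 2 * ?q - ?q)" "is_period P (of_nat 2 * ?q - sqrt 2 * ?q)"
    using Suc is_period_of_nat_mult[of P ?q 2] by (auto intro!: is_period_diff)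
  moreover have "sqrt 2 * ?q - ?q = (sqrt 2 - 1) ^ Suc k"
    "of_nat 2 * ?q - sqrt 2 * ?q = sqrt 2 * (sqrt 2 - 1) ^ Suc k"
    by (simp_all add: algebra_simps)
  ultimately show ?case by simp
qed (use assms in simp)

text \<open>Comparing both sides with the density in one tiny period \<open>(\<surd>2 - 1)\<^sup>k\<close> bounds their difference by a
  multiple of this period.\<close>

lemma periodic_density:
  fixes P :: "real set"
  assumes P: "P \<in> sets borel" and per: "is_period P 1" "is_period P (sqrt 2)" and x: "0 \<le> x"
  shows "measure lborel (P \<inter> {l..<l + x}) = x * measure lborel (P \<inter> {0..<1})"
proof -
  define q :: real where "q = sqrt 2 - 1"
  have q: "0 < q" "q < 1" by (auto simp: q_def real_less_lsqrt)
  have bound: "\<bar>measure lborel (P \<inter> {l..<l + x}) - x * measure lborel (P \<inter> {0..<1})\<bar>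
      \<le> (2 + 2 * x) * q ^ k" for k
  proof -
    define h where "h = measure lborel (P \<inter> {0..<q ^ k}) / q ^ k"
    have "is_period P (q ^ k)" "0 < q ^ k"
      using is_period_sqrt2_power[OF per] q by (auto simp: q_def)
    note approx = measure_period_approx[OF P this]
    have "\<bar>measure lborel (P \<inter> {l..<l + x}) - x * h\<bar> \<le> 2 * q ^ k"
      using approx[OF x, of l] by (simp add: h_def)
    moreover have "\<bar>measure lborel (P \<inter> {0..<1}) - h\<bar> \<le> 2 * q ^ k"
      using approx[of 1 0] by (simp add: h_def)
    then have "x * \<bar>measure lborel (P \<inter> {0..<1}) - h\<bar> \<le> x * (2 * q ^ k)"
      using x by (rule mult_left_mono)
    then have "\<bar>x * measure lborel (P \<inter> {0..<1}) - x * h\<bar> \<le> x * (2 * q ^ k)"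
      using x by (simp add: abs_mult flip: right_diff_distrib)
    ultimately show ?thesis by (simp add: algebra_simps)
  qed
  have "(\<lambda>k. (2 + 2 * x) * q ^ k) \<longlonglongrightarrow> (2 + 2 * x) * 0"
    using q by (intro tendsto_intros LIMSEQ_realpow_zero) auto
  then have "\<bar>measure lborel (P \<inter> {l..<l + x}) - x * measure lborel (P \<inter> {0..<1})\<bar> \<le> 0"
    using bound by (intro LIMSEQ_le_const) auto
  then show ?thesis by simp
qed

text \<open>If the density \<open>m\<close> is positive, then Lebesgue measure restricted to \<open>P\<close> and divided by \<open>m\<close> gives every
  interval its length and so is Lebesgue measure itself; it vanishes on the complement of \<open>P\<close>.\<close>

lemma periodic_zero_one:
  fixes P :: "real set"
  assumes P: "P \<in> sets borel" and per: "is_period P 1" "is_period P (sqrt 2)"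
  shows "emeasure lborel (P \<inter> {0..<1}) \<in> {0, 1}"
proof -
  define m where "m = measure lborel (P \<inter> {0..<1})"
  have m: "emeasure lborel (P \<inter> {0..<1}) = ennreal m"
    using emeasure_Int_Ico_finite[of P 0 1] by (simp add: m_def emeasure_eq_ennreal_measure top_unique)
  show ?thesis
  proof (cases "m = 0")
    case False
    then have "m > 0" by (simp add: m_def zero_less_measure_iff measure_nonneg less_le)
    define M where "M = scale_measure (ennreal (1 / m)) (density lborel (indicator P))"
    have dens: "emeasure (density lborel (indicator P)) A = emeasure lborel (P \<inter> A)" if "A \<in> sets borel" for A
      using that P by (intro emeasure_restricted) auto
    have "lborel = M"
    proof (rule lborel_eqI)
      fix l u :: real assume "\<And>b. b \<in> Basis \<Longrightarrow> l \<bullet> b \<le> u \<bullet> b"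
      then have lu: "l \<le> u" by simp
      have "emeasure lborel (P \<inter> box l u) = emeasure lborel (P \<inter> {l..<u})"
      proof (rule emeasure_eq_AE)
        have "AE x in lborel. x \<noteq> l" by (rule AE_lborel_singleton)
        then show "AE x in lborel. (x \<in> P \<inter> box l u) = (x \<in> P \<inter> {l..<u})"
          by eventually_elim (auto simp: box_real)
      qed (use P in auto)
      also have "\<dots> = ennreal ((u - l) * m)"
        using periodic_density[OF P per, of "u - l" l] lu emeasure_Int_Ico_finite[of P l u]
        by (simp add: m_def emeasure_eq_ennreal_measure top_unique)
      finally show "emeasure M (box l u) = (\<Prod>b\<in>Basis. (u - l) \<bullet> b)"
        using \<open>m > 0\<close> lu by (simp add: M_def dens flip: ennreal_mult)
    qed (simp add: M_def)
    then have "emeasure lborel (- P) = emeasure M (- P)" by simp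
    also have "\<dots> = 0" using P by (simp add: M_def dens)
    finally have "emeasure lborel (- P) = 0" .
    then have "AE x in lborel. x \<in> P"
      using P by (intro AE_I[where N = "- P"]) auto
    then have "emeasure lborel (P \<inter> {0..<1}) = emeasure lborel {0..<1::real}"
      using P by (intro emeasure_eq_AE) auto
    then show ?thesis by simp
  qed (simp add: m)
qed

section \<open>The rotation of the circle and its suspension flow\<close>

text \<open>The circle is represented by \<open>[0, 1)\<close> and not by a quotient of the reals, with rotations taken
  modulo 1 by \<open>frac\<close>.\<close>

definition circle :: "real measure" where
  "circle = restrict_space lborel {0..<1}"

lemma space_circle: "space circle = {0..<1}"
  by (simp add: circle_def)

lemma sets_circle: "A \<in> sets circle \<longleftrightarrow> A \<in> sets borel \<and> A \<subseteq> {0..<1}"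
  unfolding circle_def by (subst sets_restrict_space_iff) auto

lemma emeasure_circle: "A \<in> sets circle \<Longrightarrow> emeasure circle A = emeasure lborel A"
  unfolding circle_def by (subst emeasure_restrict_space) (auto simp: sets_circle[unfolded circle_def])

interpretation circle: prob_space circle
  by (rule prob_spaceI) (simp add: emeasure_circle sets_circle space_circle)

lemma measurable_from_circle [measurable]: "(\<lambda>x. x) \<in> borel_measurable circle"
  unfolding circle_def by (intro measurable_restrict_space1) simp

lemma measurable_frac_circle [measurable (raw)]:
  fixes f :: "'a \<Rightarrow> real"
  assumes [measurable]: "f \<in> borel_measurable N"
  shows "(\<lambda>x. frac (f x)) \<in> measurable N circle"
  unfolding circle_def
proof (rule measurable_restrict_space2)
  show "(\<lambda>x. frac (f x)) \<in> space N \<rightarrow> {0..<1}"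
    by (auto simp: frac_lt_1)
  show "(\<lambda>x. frac (f x)) \<in> measurable N lborel"
    unfolding frac_def by measurable
qed

lemma frac_frac_add: "frac (frac x + y) = frac (x + y)" for x y :: real
proof -
  have "\<lfloor>x - of_int \<lfloor>x\<rfloor> + y\<rfloor> = \<lfloor>x + y\<rfloor> - \<lfloor>x\<rfloor>"
    using floor_diff_of_int[of "x + y" "\<lfloor>x\<rfloor>"] by (simp only: add_diff_eq diff_add_eq)
  then show ?thesis by (simp add: frac_def)
qed

lemma frac_in_circle [simp]: "0 \<le> c \<Longrightarrow> c < 1 \<Longrightarrow> frac c = c" for c :: real
  by (simp add: frac_eq)

lemma floor_in_circle [simp]: "0 \<le> c \<Longrightarrow> c < 1 \<Longrightarrow> \<lfloor>c\<rfloor> = 0" for c :: real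
  by (simp add: floor_eq_iff)

lemma vimage_frac_circle:
  assumes "A \<in> sets circle"
  shows "frac -` A \<in> sets borel" "is_period (frac -` A) 1" "frac -` A \<inter> {0..<1} = A"
proof -
  have "(\<lambda>x::real. frac x) -` A \<inter> space borel \<in> sets borel"
    by (rule measurable_sets[OF _ assms]) measurable
  then show "frac -` A \<in> sets borel" by simp
  show "is_period (frac -` A) 1"
    by (simp add: is_period_def frac_1_eq add.commute[of 1])
  show "frac -` A \<inter> {0..<1} = A"
    using assms by (auto simp: sets_circle subset_iff)
qed

text \<open>On the line, rotating backwards turns into translating the window \<open>[0, 1)\<close> to \<open>[t, t + 1)\<close>, and a
  1-periodic set has the same measure in both windows.\<close>

lemma emeasure_circle_rotation:
  assumes A: "A \<in> sets circle"
  shows "emeasure circle ((\<lambda>c. frac (c + t)) -` A \<inter> space circle) = emeasure circle A"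
proof -
  let ?P = "frac -` A"
  note P = vimage_frac_circle[OF A]
  have "(\<lambda>c. frac (c + t)) -` A \<inter> space circle \<in> sets circle"
    by (rule measurable_sets[OF _ A]) measurable
  then have "emeasure circle ((\<lambda>c. frac (c + t)) -` A \<inter> space circle)
      = emeasure lborel ((\<lambda>c. frac (c + t)) -` A \<inter> space circle)"
    by (rule emeasure_circle)
  also have "\<dots> = emeasure lborel ((+) t -` (?P \<inter> {t..<t + 1}))"
    by (rule arg_cong[where f = "emeasure lborel"]) (auto simp: space_circle add.commute)
  also have "\<dots> = emeasure lborel (?P \<inter> {t..<t + 1})"
    using P by (intro emeasure_lborel_vimage_plus) auto
  also have "\<dots> = emeasure lborel (?P \<inter> {0..<1})"
    using P by (intro emeasure_period_interval) auto
  also have "\<dots> = emeasure circle A"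
    using P A by (simp add: emeasure_circle)
  finally show ?thesis .
qed

lemma distr_circle_rotation: "distr circle circle (\<lambda>c. frac (c + t)) = circle"
  by (rule measure_eqI) (simp_all add: emeasure_distr emeasure_circle_rotation)

lemma circle_zero_one:
  assumes A: "A \<in> sets circle"
    and inv: "\<And>c. 0 \<le> c \<Longrightarrow> c < 1 \<Longrightarrow> frac (c + sqrt 2) \<in> A \<longleftrightarrow> c \<in> A"
  shows "emeasure circle A \<in> {0, 1}"
proof -
  note P = vimage_frac_circle[OF A]
  have "is_period (frac -` A) (sqrt 2)"
    unfolding is_period_def
  proof
    fix x
    have "frac (sqrt 2 + x) = frac (frac x + sqrt 2)"
      by (simp add: frac_frac_add add.commute)
    then show "sqrt 2 + x \<in> frac -` A \<longleftrightarrow> x \<in> frac -` A"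
      using inv[of "frac x"] by (simp add: frac_lt_1)
  qed
  then show ?thesis
    using periodic_zero_one[OF P(1,2)] P(3) A by (simp add: emeasure_circle)
qed

abbreviation cylinder :: "(real \<times> real) measure" where
  "cylinder \<equiv> circle \<Otimes>\<^sub>M circle"

interpretation cylinder: pair_prob_space circle circle ..

text \<open>The first component is the time elapsed since the last integer, and \<open>\<lfloor>a + t\<rfloor>\<close> counts the integers passed
  within time \<open>t\<close>, each of which rotates the second component by \<open>\<surd>2\<close>.\<close>

definition flow :: "real \<Rightarrow> real \<times> real \<Rightarrow> real \<times> real" where
  "flow t = (\<lambda>(a, c). (frac (a + t), frac (c + of_int \<lfloor>a + t\<rfloor> * sqrt 2)))"

lemma measurable_flow: "(\<lambda>(t, \<omega>). flow t \<omega>) \<in> measurable (borel \<Otimes>\<^sub>M cylinder) cylinder"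
proof -
  let ?N = "borel \<Otimes>\<^sub>M cylinder :: (real \<times> real \<times> real) measure"
  have a: "(\<lambda>x. fst (snd x)) \<in> borel_measurable ?N" and c: "(\<lambda>x. snd (snd x)) \<in> borel_measurable ?N"
    by (rule measurable_compose[OF _ measurable_from_circle], measurable)+
  have at: "(\<lambda>x. fst (snd x) + fst x) \<in> borel_measurable ?N"
    using a by (rule borel_measurable_add) (rule measurable_fst)
  have ct: "(\<lambda>x. snd (snd x) + of_int \<lfloor>fst (snd x) + fst x\<rfloor> * sqrt 2) \<in> borel_measurable ?N"
    using c measurable_compose[OF at borel_measurable_real_floor]
    by (intro borel_measurable_add borel_measurable_times) auto
  have "(\<lambda>x. (frac (fst (snd x) + fst x), frac (snd (snd x) + of_int \<lfloor>fst (snd x) + fst x\<rfloor> * sqrt 2)))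
      \<in> measurable ?N cylinder"
    by (intro measurable_Pair measurable_frac_circle at ct)
  then show ?thesis by (simp add: flow_def case_prod_beta')
qed

lemma flow_add: "flow s (flow t \<omega>) = flow (s + t) \<omega>"
proof (cases \<omega>)
  case (Pair a c)
  have "frac (a + t) + s = a + (s + t) - of_int \<lfloor>a + t\<rfloor>"
    by (simp add: frac_def)
  then have fl: "\<lfloor>frac (a + t) + s\<rfloor> = \<lfloor>a + (s + t)\<rfloor> - \<lfloor>a + t\<rfloor>"
    by (simp only: floor_diff_of_int)
  have "frac (frac (c + of_int \<lfloor>a + t\<rfloor> * sqrt 2) + of_int \<lfloor>frac (a + t) + s\<rfloor> * sqrt 2)
      = frac (c + of_int \<lfloor>a + (s + t)\<rfloor> * sqrt 2)"
    unfolding frac_frac_add fl by (simp add: algebra_simps)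
  moreover have "frac (frac (a + t) + s) = frac (a + (s + t))"
    unfolding frac_frac_add by (simp add: algebra_simps)
  ultimately show ?thesis by (simp add: Pair flow_def)
qed

lemma space_cylinder: "space cylinder = {0..<1} \<times> {0..<1}"
  by (simp add: space_pair_measure space_circle)

lemma flow_0: "\<omega> \<in> space cylinder \<Longrightarrow> flow 0 \<omega> = \<omega>"
  by (auto simp: space_cylinder flow_def)

lemma flow_measurable [measurable]: "flow t \<in> measurable cylinder cylinder"
  using measurable_compose[OF _ measurable_flow, of "\<lambda>\<omega>. (t, \<omega>)" cylinder] by simp

text \<open>On each vertical fibre the flow acts as a rotation, and it permutes the fibres by a rotation.\<close>

lemma emeasure_cylinder_flow:
  assumes A: "A \<in> sets cylinder"
  shows "emeasure cylinder (flow t -` A \<inter> space cylinder) = emeasure cylinder A"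
proof -
  let ?g = "\<lambda>a. emeasure circle (Pair a -` A)"
  have g[measurable]: "?g \<in> borel_measurable circle"
    by (rule circle.measurable_emeasure_Pair[OF A])
  have "emeasure cylinder (flow t -` A \<inter> space cylinder)
      = (\<integral>\<^sup>+a. emeasure circle (Pair a -` (flow t -` A \<inter> space cylinder)) \<partial>circle)"
    by (rule circle.emeasure_pair_measure_alt[OF measurable_sets[OF flow_measurable A]])
  also have "\<dots> = (\<integral>\<^sup>+a. ?g (frac (a + t)) \<partial>circle)"
  proof (rule nn_integral_cong)
    fix a assume a: "a \<in> space circle"
    have "Pair a -` (flow t -` A \<inter> space cylinder)
        = (\<lambda>c. frac (c + of_int \<lfloor>a + t\<rfloor> * sqrt 2)) -` (Pair (frac (a + t)) -` A) \<inter> space circle"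
      using a by (auto simp: flow_def space_pair_measure)
    then show "emeasure circle (Pair a -` (flow t -` A \<inter> space cylinder)) = ?g (frac (a + t))"
      by (simp add: emeasure_circle_rotation sets_Pair1[OF A])
  qed
  also have "\<dots> = (\<integral>\<^sup>+a. ?g a \<partial>distr circle circle (\<lambda>a. frac (a + t)))"
    by (subst nn_integral_distr) auto
  also have "\<dots> = emeasure cylinder A"
    by (simp only: distr_circle_rotation circle.emeasure_pair_measure_alt[OF A])
  finally show ?thesis .
qed

lemma distr_flow: "distr cylinder cylinder (flow t) = cylinder"
  by (rule measure_eqI) (simp_all add: emeasure_distr emeasure_cylinder_flow)

text \<open>The flow carries the fibre over \<open>0\<close> to the fibre over \<open>a\<close> without rotating it, so all fibres of an
  invariant set coincide. The time-one map rotates the fibre over \<open>0\<close> by \<open>\<surd>2\<close>.\<close>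

lemma ergodic_flow: "ergodic_group cylinder flow"
  unfolding ergodic_group_def measure_preserving_group_def
proof (intro conjI allI ballI impI)
  fix D assume D: "D \<in> sets cylinder" and inv: "\<forall>z. flow z ` D = D"
  have Dsub: "D \<subseteq> {0..<1} \<times> {0..<1}"
    using sets.sets_into_space[OF D] by (simp add: space_cylinder)
  have iff: "flow z \<omega> \<in> D \<longleftrightarrow> \<omega> \<in> D" if "\<omega> \<in> space cylinder" for z \<omega>
  proof
    assume "flow z \<omega> \<in> D"
    then have "flow (- z) (flow z \<omega>) \<in> D" using inv by blast
    then show "\<omega> \<in> D" using that by (simp add: flow_add flow_0)
  qed (use inv in blast)
  have D0: "Pair 0 -` D \<in> sets circle" by (rule sets_Pair1[OF D])
  have "emeasure circle (Pair 0 -` D) \<in> {0, 1}"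
  proof (rule circle_zero_one[OF D0])
    fix c :: real assume c: "0 \<le> c" "c < 1"
    have "flow 1 (0, c) = (0, frac (c + sqrt 2))" by (simp add: flow_def frac_def)
    then show "frac (c + sqrt 2) \<in> Pair 0 -` D \<longleftrightarrow> c \<in> Pair 0 -` D"
      using iff[of "(0, c)" 1] c by (simp add: space_cylinder)
  qed
  moreover have "emeasure cylinder D = emeasure circle (Pair 0 -` D)"
  proof -
    have "Pair a -` D = Pair 0 -` D" if a: "a \<in> space circle" for a
    proof -
      have "(a, c) \<in> D \<longleftrightarrow> (0, c) \<in> D" if c: "0 \<le> c" "c < 1" for c
      proof -
        have "flow a (0, c) = (a, c)"
          using a c by (auto simp: flow_def space_circle)
        then show ?thesis using iff[of "(0, c)" a] c by (simp add: space_cylinder)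
      qed
      then show ?thesis using Dsub by auto
    qed
    then have "(\<integral>\<^sup>+a. emeasure circle (Pair a -` D) \<partial>circle) = (\<integral>\<^sup>+a. emeasure circle (Pair 0 -` D) \<partial>circle)"
      by (intro nn_integral_cong) simp
    then show ?thesis
      by (simp add: circle.emeasure_pair_measure_alt[OF D] circle.emeasure_space_1)
  qed
  ultimately show "measure cylinder D \<in> {0, 1}"
    by (auto simp: measure_def)
qed (use measurable_flow flow_measurable distr_flow flow_add flow_0 in auto)

section \<open>Continuously differentiable interpolation of sequences\<close>

text \<open>A quadratic spline rising from \<open>0\<close> on \<open>(-\<infinity>, 0]\<close> to \<open>1\<close> on \<open>[1, \<infinity>)\<close>. Squares of positive parts are
  continuously differentiable, so this form makes the smoothness at the knots \<open>0\<close>, \<open>1/2\<close>, \<open>1\<close> automatic.\<close>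

definition ramp :: "real \<Rightarrow> real" where
  "ramp t = 2 * (max 0 t)\<^sup>2 - 4 * (max 0 (t - 1/2))\<^sup>2 + 2 * (max 0 (t - 1))\<^sup>2"

definition ramp_deriv :: "real \<Rightarrow> real" where
  "ramp_deriv t = 4 * max 0 t - 8 * max 0 (t - 1/2) + 4 * max 0 (t - 1)"

lemma max_zero_squared_has_derivative:
  "((\<lambda>t. (max 0 t)\<^sup>2) has_real_derivative 2 * max 0 x) (at x)"
proof -
  consider "x > 0" | "x < 0" | "x = 0" by linarith
  then show ?thesis
  proof cases
    case 1
    have "((\<lambda>t. t\<^sup>2) has_real_derivative 2 * max 0 x) (at x)"
      using 1 by (auto intro!: derivative_eq_intros)
    then show ?thesis
      by (rule has_field_derivative_transform_within_open[where S = "{0<..}"]) (use 1 in auto)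
  next
    case 2
    have "((\<lambda>t. 0) has_real_derivative 2 * max 0 x) (at x)"
      using 2 by (auto intro!: derivative_eq_intros)
    then show ?thesis
      by (rule has_field_derivative_transform_within_open[where S = "{..<0}"]) (use 2 in auto)
  next
    case 3
    have "(\<lambda>h. (max 0 h)\<^sup>2 / h :: real) \<midarrow>0\<rightarrow> 0"
    proof (rule tendsto_rabs_zero_cancel, rule tendsto_sandwich[where f = "\<lambda>_. 0" and h = abs])
      show "\<forall>\<^sub>F h in at (0::real). \<bar>(max 0 h)\<^sup>2 / h\<bar> \<le> \<bar>h\<bar>"
        by (auto simp: max_def power2_eq_square)
      show "abs \<midarrow>0\<rightarrow> (0::real)" by (rule tendsto_rabs_zero) simp
    qed auto
    then show ?thesis using 3 by (simp add: has_field_derivative_iff)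
  qed
qed

lemma ramp_has_derivative: "(ramp has_real_derivative ramp_deriv t) (at t)"
proof -
  have "((\<lambda>t. (max 0 (t - s))\<^sup>2) has_real_derivative 2 * max 0 (t - s) * 1) (at t)" for s
    by (rule DERIV_chain2[OF max_zero_squared_has_derivative]) (auto intro!: derivative_eq_intros)
  note D = DERIV_cmult[OF this]
  show ?thesis
    using DERIV_add[OF DERIV_diff[OF D[of 2 0] D[of 4 "1/2"]] D[of 2 1]]
    by (simp add: ramp_def[abs_def] ramp_deriv_def algebra_simps)
qed

lemma ramp_simps:
  "t \<le> 0 \<Longrightarrow> ramp t = 0" "t \<le> 0 \<Longrightarrow> ramp_deriv t = 0"
  "1 \<le> t \<Longrightarrow> ramp t = 1" "1 \<le> t \<Longrightarrow> ramp_deriv t = 0"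
  by (auto simp: ramp_def ramp_deriv_def max_def power2_eq_square algebra_simps)

lemma ramp_deriv_bounds: "0 \<le> ramp_deriv t" "ramp_deriv t \<le> 2"
  by (auto simp: ramp_deriv_def max_def)

lemma ramp_bounds: "0 \<le> ramp t" "ramp t \<le> 1"
proof -
  have mono: "ramp s \<le> ramp t" if "s \<le> t" for s t
  proof (rule DERIV_nonneg_imp_nondecreasing[OF that])
    show "\<exists>D. (ramp has_real_derivative D) (at x) \<and> 0 \<le> D" for x
      using ramp_has_derivative[of x] ramp_deriv_bounds(1)[of x] by metis
  qed
  show "0 \<le> ramp t"
    using mono[of "min t 0" t] ramp_simps(1)[of "min t 0"] by simp
  show "ramp t \<le> 1"
    using mono[of t "max t 1"] ramp_simps(3)[of "max t 1"] by simp
qed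

definition interpolate :: "(int \<Rightarrow> real) \<Rightarrow> real \<Rightarrow> real" where
  "interpolate x y = x \<lfloor>y\<rfloor> + (x (\<lfloor>y\<rfloor> + 1) - x \<lfloor>y\<rfloor>) * ramp (frac y)"

definition interpolate_deriv :: "(int \<Rightarrow> real) \<Rightarrow> real \<Rightarrow> real" where
  "interpolate_deriv x y = (x (\<lfloor>y\<rfloor> + 1) - x \<lfloor>y\<rfloor>) * ramp_deriv (frac y)"

text \<open>This formula is valid on both sides of the integer \<open>m\<close>, which reduces smoothness at the integers to
  smoothness of \<open>ramp\<close>.\<close>

lemma interpolate_local:
  assumes "of_int m - 1 < y" "y < of_int m + 1"
  shows "interpolate x y = x (m - 1) + (x m - x (m - 1)) * ramp (y - of_int m + 1)
            + (x (m + 1) - x m) * ramp (y - of_int m)" (is ?value)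
    and "interpolate_deriv x y = (x m - x (m - 1)) * ramp_deriv (y - of_int m + 1)
            + (x (m + 1) - x m) * ramp_deriv (y - of_int m)" (is ?deriv)
proof -
  consider "\<lfloor>y\<rfloor> = m - 1" "y \<le> of_int m" | "\<lfloor>y\<rfloor> = m" "of_int m \<le> y"
    using assms by (cases "y < of_int m") (auto simp: floor_eq_iff)
  then have "?value \<and> ?deriv"
    by cases (auto simp: interpolate_def interpolate_deriv_def frac_def ramp_simps algebra_simps)
  then show ?value ?deriv by blast+
qed

lemma interpolate_has_derivative:
  "(interpolate x has_real_derivative interpolate_deriv x y) (at y)"
proof -
  define m where "m = \<lfloor>y\<rfloor>"
  have y: "y \<in> {of_int m - 1<..<of_int m + 1}"
    by (auto simp: m_def) linarith
  have shift: "((\<lambda>y. ramp (y - of_int m + s)) has_real_derivative ramp_deriv (y - of_int m + s)) (at y)" for s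
  proof -
    have "((\<lambda>y. y - of_int m + s) has_real_derivative 1) (at y)"
      by (auto intro!: derivative_eq_intros)
    from DERIV_chain2[OF ramp_has_derivative this] show ?thesis by simp
  qed
  have "((\<lambda>y. x (m - 1) + (x m - x (m - 1)) * ramp (y - of_int m + 1)
            + (x (m + 1) - x m) * ramp (y - of_int m + 0))
        has_real_derivative 0 + (x m - x (m - 1)) * ramp_deriv (y - of_int m + 1)
            + (x (m + 1) - x m) * ramp_deriv (y - of_int m + 0)) (at y)"
    by (intro DERIV_add DERIV_const DERIV_cmult shift)
  then have "((\<lambda>y. x (m - 1) + (x m - x (m - 1)) * ramp (y - of_int m + 1)
            + (x (m + 1) - x m) * ramp (y - of_int m))
        has_real_derivative interpolate_deriv x y) (at y)"
    using interpolate_local(2)[of m y x] y by simp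
  then show ?thesis
    by (rule has_field_derivative_transform_within_open[where S = "{of_int m - 1<..<of_int m + 1}"])
      (use y interpolate_local(1)[of m _ x] in auto)
qed

lemma continuous_interpolate_deriv: "continuous_on UNIV (interpolate_deriv x)"
proof -
  have "isCont (interpolate_deriv x) y" for y
  proof -
    define m where "m = \<lfloor>y\<rfloor>"
    define U where "U = {of_int m - 1<..<of_int m + 1 :: real}"
    have y: "y \<in> U" by (auto simp: m_def U_def) linarith
    have "continuous_on U (\<lambda>y. (x m - x (m - 1)) * ramp_deriv (y - of_int m + 1)
            + (x (m + 1) - x m) * ramp_deriv (y - of_int m))"
      unfolding ramp_deriv_def by (intro continuous_intros)
    then have "continuous_on U (interpolate_deriv x)"
      using interpolate_local(2)[of m _ x] by (subst continuous_on_cong[OF refl]) (auto simp: U_def)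
    then show ?thesis
      using y by (simp add: U_def continuous_on_eq_continuous_at)
  qed
  then show ?thesis by (simp add: continuous_at_imp_continuous_on)
qed

lemma interpolate_of_int: "interpolate x (of_int n) = x n"
  by (simp add: interpolate_def ramp_simps)

lemma interpolate_shift: "interpolate x (y + of_int n) = interpolate (\<lambda>i. x (i + n)) y"
  by (simp add: interpolate_def frac_def algebra_simps)

lemma interpolate_bounds:
  assumes "\<And>n. x n \<in> {0..1}"
  shows "0 \<le> interpolate x y" "interpolate x y \<le> 1" "\<bar>interpolate_deriv x y\<bar> \<le> 2"
proof -
  define s u v where "s = ramp (frac y)" "u = x \<lfloor>y\<rfloor>" "v = x (\<lfloor>y\<rfloor> + 1)"
  have b: "0 \<le> s" "s \<le> 1" "0 \<le> u" "u \<le> 1" "0 \<le> v" "v \<le> 1"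
    using ramp_bounds[of "frac y"] assms[of "\<lfloor>y\<rfloor>"] assms[of "\<lfloor>y\<rfloor> + 1"] by (auto simp: s_u_v_def)
  have eq: "interpolate x y = (1 - s) * u + s * v"
    by (simp add: interpolate_def s_u_v_def algebra_simps)
  show "0 \<le> interpolate x y" unfolding eq using b by simp
  show "interpolate x y \<le> 1" unfolding eq using b by (intro convex_bound_le) auto
  have "\<bar>interpolate_deriv x y\<bar> = \<bar>v - u\<bar> * ramp_deriv (frac y)"
    using ramp_deriv_bounds by (simp add: interpolate_deriv_def abs_mult s_u_v_def)
  also have "\<dots> \<le> 1 * 2"
    using b ramp_deriv_bounds by (intro mult_mono) auto
  finally show "\<bar>interpolate_deriv x y\<bar> \<le> 2" by simp
qed

lemma affine_interpolate_C11:
  assumes x: "\<And>n. x n \<in> {0..1}"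
  shows "(\<lambda>r. b * interpolate x (a + r) - c) \<in> C11"
proof -
  let ?f = "\<lambda>r. b * interpolate x (a + r) - c"
  have deriv: "(?f has_real_derivative b * interpolate_deriv x (a + r)) (at r)" for r
  proof -
    have "((\<lambda>r. interpolate x (a + r)) has_real_derivative interpolate_deriv x (a + r) * 1) (at r)"
      by (rule DERIV_chain2[OF interpolate_has_derivative]) (auto intro!: derivative_eq_intros)
    then show ?thesis by (auto intro!: derivative_eq_intros)
  qed
  have "\<bar>?f r\<bar> \<le> \<bar>b\<bar> * 1 + \<bar>c\<bar>" for r
  proof -
    have "\<bar>b * interpolate x (a + r)\<bar> \<le> \<bar>b\<bar> * 1"
      using interpolate_bounds[OF x, where y = "a + r"] by (simp add: abs_mult mult_left_le)
    then show ?thesis by linarith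
  qed
  then have bounded: "bounded (range ?f)"
    by (auto simp: bounded_iff)
  have "continuous_on UNIV (\<lambda>r. b * interpolate_deriv x (a + r))"
    by (intro continuous_intros continuous_on_compose2[OF continuous_interpolate_deriv]) auto
  then have C1: "?f C1_differentiable_on UNIV"
    using deriv unfolding C1_differentiable_on_def has_real_derivative_iff_has_vector_derivative
    by (intro exI[of _ "\<lambda>r. b * interpolate_deriv x (a + r)"]) simp
  have "(2 * \<bar>b\<bar>)-lipschitz_on UNIV ?f"
  proof (rule bounded_derivative_imp_lipschitz)
    fix r
    show "(?f has_derivative (*) (b * interpolate_deriv x (a + r))) (at r within UNIV)"
      using deriv by (simp add: has_field_derivative_def)
    show "onorm ((*) (b * interpolate_deriv x (a + r))) \<le> 2 * \<bar>b\<bar>"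
    proof (rule onorm_bound)
      fix h
      show "norm (b * interpolate_deriv x (a + r) * h) \<le> 2 * \<bar>b\<bar> * norm h"
        using mult_right_mono[OF mult_left_mono[OF interpolate_bounds(3)[OF x, where y = "a + r"], of "\<bar>b\<bar>"], of "\<bar>h\<bar>"]
        by (simp add: abs_mult mult.commute)
    qed simp
  qed auto
  with bounded C1 show ?thesis by (auto simp: C11_def)
qed

lemma min_radius_attained:
  fixes f :: "real \<Rightarrow> real"
  assumes cont: "continuous_on UNIV f" and ex: "\<bar>f r\<^sub>0\<bar> \<le> 1"
  shows "min_radius f \<in> small_radii f" "\<And>r. \<bar>r\<bar> < min_radius f \<Longrightarrow> 1 < \<bar>f r\<bar>"
proof -
  let ?S = "{r. \<bar>f r\<bar> \<le> 1}"
  have "closed ?S"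
    using cont by (intro closed_Collect_le continuous_intros) auto
  moreover have "?S \<noteq> {}" using ex by blast
  ultimately obtain r where r: "r \<in> ?S" and least: "\<And>s. s \<in> ?S \<Longrightarrow> dist 0 r \<le> dist 0 s"
    by (rule distance_attains_inf[where a = 0]) blast
  have "min_radius f = \<bar>r\<bar>"
    unfolding min_radius_def
  proof (rule cInf_eq_minimum)
    show "\<bar>r\<bar> \<in> small_radii f" using r by (auto simp: small_radii_def)
    show "\<bar>r\<bar> \<le> s" if "s \<in> small_radii f" for s
      using that least by (auto simp: small_radii_def)
  qed
  then show "min_radius f \<in> small_radii f"
    using r by (auto simp: small_radii_def)
  fix s assume "\<bar>s\<bar> < min_radius f"
  then have "\<not> dist 0 r \<le> dist 0 s" using \<open>min_radius f = \<bar>r\<bar>\<close> by simp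
  then show "1 < \<bar>f s\<bar>" using least[of s] by force
qed

section \<open>Rokhlin towers over short arcs\<close>

text \<open>The two sides contain the prime 2 to an odd and to an even power.\<close>

lemma double_square_neq_square:
  fixes j m :: int
  assumes "j \<noteq> 0"
  shows "2 * j\<^sup>2 \<noteq> m\<^sup>2"
proof
  assume eq: "2 * j\<^sup>2 = m\<^sup>2"
  then have "m \<noteq> 0" using assms by auto
  have p: "prime_elem (2 :: int)" by simp
  have "multiplicity 2 (2 * j\<^sup>2) = 1 + 2 * multiplicity 2 j"
    using assms by (simp add: prime_elem_multiplicity_mult_distrib[OF p] prime_elem_multiplicity_power_distrib[OF p])
  moreover have "multiplicity 2 (m\<^sup>2) = 2 * multiplicity 2 m"
    using \<open>m \<noteq> 0\<close> by (simp add: prime_elem_multiplicity_power_distrib[OF p])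
  ultimately have "1 + 2 * multiplicity 2 j = 2 * multiplicity 2 m" using eq by simp
  then show False by presburger
qed

text \<open>The norm \<open>2j\<^sup>2 - m\<^sup>2 = (j\<surd>2 - m)(j\<surd>2 + m)\<close> is a nonzero integer, and its second factor is at most
  \<open>4\<bar>j\<bar>\<close> when the first one is small.\<close>

lemma sqrt2_badly_approximable:
  fixes j m :: int
  assumes j: "j \<noteq> 0"
  shows "1 \<le> 4 * \<bar>real_of_int j\<bar> * \<bar>of_int j * sqrt 2 - of_int m\<bar>"
proof -
  define x where "x = of_int j * sqrt 2"
  have j1: "1 \<le> \<bar>real_of_int j\<bar>" using j by linarith
  show ?thesis
  proof (cases "1 \<le> \<bar>x - of_int m\<bar>")
    case True
    then have "1 * 1 \<le> 4 * \<bar>real_of_int j\<bar> * \<bar>x - of_int m\<bar>"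
      using j1 by (intro mult_mono) auto
    then show ?thesis by (simp add: x_def)
  next
    case False
    have "sqrt 2 \<le> 3 / 2" by (rule real_le_lsqrt) (auto simp: power2_eq_square)
    then have "\<bar>x\<bar> \<le> \<bar>real_of_int j\<bar> * (3 / 2)"
      unfolding x_def abs_mult by (intro mult_left_mono) auto
    then have le: "\<bar>x + of_int m\<bar> \<le> 4 * \<bar>real_of_int j\<bar>"
      using False j1 by linarith
    have "x\<^sup>2 - (of_int m)\<^sup>2 = real_of_int (2 * j\<^sup>2 - m\<^sup>2)"
      by (simp add: x_def power_mult_distrib)
    moreover have "1 \<le> \<bar>2 * j\<^sup>2 - m\<^sup>2\<bar>"
      using double_square_neq_square[OF j, of m] by linarith
    ultimately have "1 \<le> \<bar>x\<^sup>2 - (of_int m)\<^sup>2\<bar>"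
      by (metis of_int_1_le_iff of_int_abs)
    also have "x\<^sup>2 - (of_int m)\<^sup>2 = (x + of_int m) * (x - of_int m)"
      by (simp add: power2_eq_square algebra_simps)
    also have "\<bar>\<dots>\<bar> \<le> 4 * \<bar>real_of_int j\<bar> * \<bar>x - of_int m\<bar>"
      unfolding abs_mult using le by (intro mult_right_mono) auto
    finally show ?thesis by (simp add: x_def)
  qed
qed

text \<open>The \<open>j\<close>-th rotate of the base arc \<open>[0, 1 / (60 \<sqdot> 8\<^sup>k))\<close>. The length of the arc is small enough to make
  the measures of the towers below summable, with sum at most \<open>1/6\<close>, and large enough for their
  products with the heights \<open>4\<^sup>k\<close> to be unbounded.\<close>

definition level :: "nat \<Rightarrow> int \<Rightarrow> real set" where
  "level k j = (\<lambda>c. frac (c + (- of_int j * sqrt 2))) -` {0..<1 / (60 * 8 ^ k)} \<inter> space circle"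

definition tower :: "nat \<Rightarrow> int \<Rightarrow> real set" where
  "tower k h = (\<Union>j\<in>{-h..h}. level k j)"

text \<open>The towers have twice the height of those on which the speed will be shown to be fast for a long
  time: from a level \<open>j\<close> with \<open>\<bar>j\<bar> \<le> 4\<^sup>k\<close>, the orbit stays in \<open>spikes\<close> for \<open>4\<^sup>k\<close> steps in both directions.\<close>

definition spikes :: "real set" where
  "spikes = (\<Union>k. tower k (2 * 4 ^ k))"

lemma width_less_1: "1 / (60 * 8 ^ k) < (1 :: real)"
proof -
  have "1 \<le> (8 :: real) ^ k" by simp
  then have "1 < 60 * (8 :: real) ^ k" by linarith
  then show ?thesis by simp
qed

lemma base_sets: "{0..<1 / (60 * 8 ^ k)} \<in> sets circle"
  using width_less_1[of k] by (auto simp: sets_circle)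

lemma sets_level [measurable]: "level k j \<in> sets circle"
  unfolding level_def by (rule measurable_sets[OF _ base_sets]) measurable

lemma emeasure_level: "emeasure circle (level k j) = ennreal (1 / (60 * 8 ^ k))"
  unfolding level_def emeasure_circle_rotation[OF base_sets] using base_sets
  by (simp add: emeasure_circle)

text \<open>Two rotates of the base arc can meet only if \<open>(i - j)\<surd>2\<close> is closer to an integer than the length of the arc,
  which bad approximability excludes for \<open>\<bar>i - j\<bar> \<le> 2 \<sqdot> 4\<^sup>k\<close>.\<close>

lemma level_disjoint:
  assumes ij: "i \<noteq> j" "\<bar>i - j\<bar> \<le> 2 * 4 ^ k"
  shows "level k i \<inter> level k j = {}"
proof (rule ccontr)
  assume "level k i \<inter> level k j \<noteq> {}"
  then obtain c where c: "frac (c + - of_int i * sqrt 2) < 1 / (60 * 8 ^ k)"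
      "frac (c + - of_int j * sqrt 2) < 1 / (60 * 8 ^ k)"
    by (auto simp: level_def)
  define m where "m = \<lfloor>c + - of_int j * sqrt 2\<rfloor> - \<lfloor>c + - of_int i * sqrt 2\<rfloor>"
  have "of_int (i - j) * sqrt 2 - of_int m = frac (c + - of_int j * sqrt 2) - frac (c + - of_int i * sqrt 2)"
    by (simp add: m_def frac_def algebra_simps)
  then have close: "\<bar>of_int (i - j) * sqrt 2 - of_int m\<bar> \<le> 1 / (60 * 8 ^ k)"
    using c frac_ge_0[of "c + - of_int j * sqrt 2"] frac_ge_0[of "c + - of_int i * sqrt 2"] by linarith
  have "real_of_int \<bar>i - j\<bar> \<le> real_of_int (2 * 4 ^ k)" using ij(2) by (simp only: of_int_le_iff)
  then have "4 * \<bar>real_of_int (i - j)\<bar> * \<bar>of_int (i - j) * sqrt 2 - of_int m\<bar>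
      \<le> 4 * (2 * 4 ^ k) * (1 / (60 * 8 ^ k))"
    using close by (intro mult_mono) auto
  also have "\<dots> < 1"
  proof -
    have "(4 :: real) ^ k \<le> 8 ^ k" by (rule power_mono) auto
    then have "8 * 4 ^ k < 60 * (8 :: real) ^ k" using zero_less_power[of "8::real" k] by linarith
    then show ?thesis by simp
  qed
  finally show False using sqrt2_badly_approximable[of "i - j" m] ij(1) by simp
qed

lemma sets_tower [measurable]: "tower k h \<in> sets circle"
  unfolding tower_def by (intro sets.finite_UN) auto

lemma sets_spikes [measurable]: "spikes \<in> sets circle"
  unfolding spikes_def by measurable

lemma sum_emeasure_levels:
  assumes "0 \<le> h"
  shows "(\<Sum>j\<in>{-h..h}. emeasure circle (level k j)) = ennreal ((2 * h + 1) / (60 * 8 ^ k))"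
proof -
  have "(\<Sum>j\<in>{-h..h}. emeasure circle (level k j)) = ennreal (\<Sum>j\<in>{-h..h}. 1 / (60 * 8 ^ k))"
    unfolding emeasure_level by (rule sum_ennreal) simp
  also have "(\<Sum>j\<in>{-h..h}. 1 / (60 * 8 ^ k)) = (2 * real_of_int h + 1) / (60 * 8 ^ k)"
    using assms by simp
  finally show ?thesis by simp
qed

lemma emeasure_tower_le:
  assumes "0 \<le> h"
  shows "emeasure circle (tower k h) \<le> ennreal ((2 * h + 1) / (60 * 8 ^ k))"
  unfolding tower_def sum_emeasure_levels[OF assms, symmetric]
  by (rule emeasure_subadditive_finite) auto

lemma emeasure_half_tower:
  "emeasure circle (tower k (4 ^ k)) = ennreal ((2 * 4 ^ k + 1) / (60 * 8 ^ k))"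
proof -
  have "disjoint_family_on (level k) {-(4 ^ k)..4 ^ k}"
    unfolding disjoint_family_on_def by (intro ballI impI level_disjoint) (auto simp: abs_le_iff)
  then have "emeasure circle (tower k (4 ^ k)) = (\<Sum>j\<in>{-(4 ^ k)..4 ^ k}. emeasure circle (level k j))"
    unfolding tower_def by (subst sum_emeasure) auto
  also have "\<dots> = ennreal ((2 * 4 ^ k + 1) / (60 * 8 ^ k))"
    using sum_emeasure_levels[of "4 ^ k" k] by simp
  finally show ?thesis .
qed

lemma emeasure_spikes_le: "emeasure circle spikes \<le> ennreal (1 / 6)"
proof -
  have "emeasure circle spikes \<le> (\<Sum>k. emeasure circle (tower k (2 * 4 ^ k)))"
    unfolding spikes_def by (rule emeasure_subadditive_countably) auto
  also have "\<dots> \<le> (\<Sum>k. ennreal (1 / 12 * (1 / 2) ^ k))"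
  proof (intro suminf_le summableI)
    fix k
    have "(8 :: real) ^ k = 4 ^ k * 2 ^ k" by (simp flip: power_mult_distrib)
    moreover have "1 \<le> (4 :: real) ^ k" by simp
    ultimately have "(2 * real_of_int (2 * 4 ^ k) + 1) / (60 * 8 ^ k) \<le> 1 / 12 * (1 / 2) ^ k"
      by (simp add: field_simps)
    from order.trans[OF emeasure_tower_le ennreal_leI[OF this]]
    show "emeasure circle (tower k (2 * 4 ^ k)) \<le> ennreal (1 / 12 * (1 / 2) ^ k)" by simp
  qed
  also have "\<dots> = ennreal (1 / 12 * (1 / (1 - 1 / 2)))"
    by (intro suminf_ennreal_eq sums_mult geometric_sums) auto
  finally show ?thesis by simp
qed

definition visits :: "real \<Rightarrow> int \<Rightarrow> real" where
  "visits c n = indicator spikes (frac (c + of_int n * sqrt 2))"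

lemma visits_in_01: "visits c n \<in> {0..1}"
  by (simp add: visits_def indicator_def)

lemma visits_rotate: "visits (frac (c + of_int m * sqrt 2)) n = visits c (n + m)"
  by (simp add: visits_def frac_frac_add algebra_simps)

lemma visits_half_tower:
  assumes c: "c \<in> tower k (4 ^ k)" and n: "\<bar>n\<bar> \<le> 4 ^ k"
  shows "visits c n = 1"
proof -
  obtain j where j: "- (4 ^ k) \<le> j" "j \<le> 4 ^ k" "frac (c + - of_int j * sqrt 2) < 1 / (60 * 8 ^ k)"
    using c by (auto simp: tower_def level_def)
  have "frac (frac (c + of_int n * sqrt 2) + - of_int (j + n) * sqrt 2) = frac (c + - of_int j * sqrt 2)"
    unfolding frac_frac_add by (simp add: algebra_simps)
  then have "frac (c + of_int n * sqrt 2) \<in> level k (j + n)"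
    using j(3) by (simp add: level_def space_circle frac_lt_1)
  moreover have "j + n \<in> {- (2 * 4 ^ k)..2 * 4 ^ k}" using j(1,2) n by auto
  ultimately have "frac (c + of_int n * sqrt 2) \<in> spikes"
    unfolding spikes_def tower_def by blast
  then show ?thesis by (simp add: visits_def)
qed

text \<open>The points whose whole orbit stays in \<open>spikes\<close> form an invariant set that is too small to have
  full measure.\<close>

lemma AE_visits_zero: "AE \<omega> in cylinder. \<exists>n. visits (snd \<omega>) n = 0"
proof -
  define Z where "Z = (\<Inter>n::int. (\<lambda>c. frac (c + of_int n * sqrt 2)) -` spikes \<inter> space circle)"
  have Z: "Z \<in> sets circle"
    unfolding Z_def by (intro sets.countable_INT' measurable_sets[OF _ sets_spikes]) auto
  have mem: "c \<in> Z \<longleftrightarrow> c \<in> space circle \<and> (\<forall>n. visits c n \<noteq> 0)" for c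
    by (auto simp: Z_def visits_def indicator_def)
  have "emeasure circle Z \<in> {0, 1}"
  proof (rule circle_zero_one[OF Z])
    fix c :: real assume c: "0 \<le> c" "c < 1"
    have "visits (frac (c + sqrt 2)) n = visits c (n + 1)" for n
      using visits_rotate[of c 1 n] by simp
    then have "(\<forall>n. visits (frac (c + sqrt 2)) n \<noteq> 0) \<longleftrightarrow> (\<forall>n. visits c n \<noteq> 0)"
      by (metis diff_add_cancel)
    then show "frac (c + sqrt 2) \<in> Z \<longleftrightarrow> c \<in> Z"
      using c by (simp add: mem space_circle frac_lt_1)
  qed
  moreover have "emeasure circle Z \<le> emeasure circle spikes"
  proof (rule emeasure_mono)
    show "Z \<subseteq> spikes"
    proof
      fix c assume "c \<in> Z"
      then have "visits c 0 \<noteq> 0" "c \<in> space circle" using mem by blast+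
      then show "c \<in> spikes" by (simp add: visits_def space_circle indicator_def split: if_splits)
    qed
  qed simp
  moreover have "emeasure circle spikes < 1"
    using emeasure_spikes_le by (rule le_less_trans) (simp add: ennreal_less_one_iff)
  ultimately have "emeasure circle Z = 0" by auto
  then have "emeasure cylinder (space circle \<times> Z) = 0"
    using Z by (simp add: circle.emeasure_pair_measure_Times)
  then show ?thesis
    using Z mem by (intro AE_I'[of "space circle \<times> Z"]) (auto simp: null_sets_def space_pair_measure)
qed

section \<open>The random speed\<close>

definition excursion :: "real \<Rightarrow> real \<times> real \<Rightarrow> real" where
  "excursion y \<omega> = interpolate (visits (snd \<omega>)) (fst \<omega> + y)"

lemma excursion_bounds: "0 \<le> excursion y \<omega>" "excursion y \<omega> \<le> 1"
  using interpolate_bounds(1,2)[OF visits_in_01] by (simp_all add: excursion_def)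

lemma excursion_flow: "excursion y (flow z \<omega>) = excursion (y + z) \<omega>"
proof (cases \<omega>)
  case (Pair a c)
  define m where "m = \<lfloor>a + z\<rfloor>"
  have "visits (frac (c + of_int m * sqrt 2)) = (\<lambda>n. visits c (n + m))"
    by (simp add: fun_eq_iff visits_rotate)
  then have "excursion y (flow z \<omega>) = interpolate (visits c) (frac (a + z) + y + of_int m)"
    by (simp add: Pair excursion_def flow_def m_def interpolate_shift)
  also have "frac (a + z) + y + of_int m = a + (y + z)"
    by (simp add: m_def frac_def)
  finally show ?thesis by (simp add: Pair excursion_def)
qed

lemma excursion_0:
  assumes "\<omega> \<in> space cylinder"
  shows "excursion 0 \<omega> = indicator spikes (snd \<omega>)
    + (indicator spikes (frac (snd \<omega> + sqrt 2)) - indicator spikes (snd \<omega>)) * ramp (fst \<omega>)"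
  using assms by (auto simp: excursion_def interpolate_def visits_def space_cylinder)

lemma measurable_excursion_0 [measurable]: "excursion 0 \<in> borel_measurable cylinder"
proof -
  have ramp: "ramp \<in> borel_measurable borel"
    using ramp_has_derivative
    by (intro borel_measurable_continuous_onI) (blast intro: DERIV_isCont continuous_at_imp_continuous_on)
  have fst: "(\<lambda>\<omega>. fst \<omega>) \<in> borel_measurable cylinder" and snd: "(\<lambda>\<omega>. snd \<omega>) \<in> borel_measurable cylinder"
    by (rule measurable_compose[OF _ measurable_from_circle], measurable)+
  have spikes: "(indicator spikes :: real \<Rightarrow> real) \<in> borel_measurable circle"
    by simp
  have "(\<lambda>\<omega>. snd \<omega> + sqrt 2) \<in> borel_measurable cylinder"
    using snd by simp
  then have rot: "(\<lambda>\<omega>. frac (snd \<omega> + sqrt 2)) \<in> measurable cylinder circle"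
    by (rule measurable_frac_circle)
  have "(\<lambda>\<omega>. indicator spikes (snd \<omega>)
    + (indicator spikes (frac (snd \<omega> + sqrt 2)) - indicator spikes (snd \<omega>)) * ramp (fst \<omega>))
    \<in> borel_measurable cylinder"
    using measurable_compose[OF measurable_snd spikes, of circle] measurable_compose[OF rot spikes]
      measurable_compose[OF fst ramp]
    by (intro borel_measurable_add borel_measurable_times borel_measurable_diff) auto
  then show ?thesis
    by (subst measurable_cong[OF excursion_0])
qed

lemma measurable_excursion: "(\<lambda>(y, \<omega>). excursion y \<omega>) \<in> borel_measurable (borel \<Otimes>\<^sub>M cylinder)"
  using measurable_compose[OF measurable_flow measurable_excursion_0]
  by (simp add: case_prod_beta' excursion_flow)

definition mean_excursion :: real where
  "mean_excursion = (\<integral>\<omega>. excursion 0 \<omega> \<partial>cylinder)"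

lemma integrable_excursion: "integrable cylinder (excursion y)"
  and integral_excursion: "(\<integral>\<omega>. excursion y \<omega> \<partial>cylinder) = mean_excursion"
proof -
  have eq: "excursion y = (\<lambda>\<omega>. excursion 0 (flow y \<omega>))" by (simp add: excursion_flow)
  have [measurable]: "excursion y \<in> borel_measurable cylinder"
    unfolding eq by measurable
  show "integrable cylinder (excursion y)"
    by (rule cylinder.P.integrable_const_bound[where B = 1]) (auto simp: excursion_bounds)
  have "mean_excursion = (\<integral>\<omega>. excursion 0 \<omega> \<partial>distr cylinder cylinder (flow y))"
    by (simp add: distr_flow mean_excursion_def)
  also have "\<dots> = (\<integral>\<omega>. excursion y \<omega> \<partial>cylinder)"
    unfolding eq by (rule integral_distr) measurable
  finally show "(\<integral>\<omega>. excursion y \<omega> \<partial>cylinder) = mean_excursion" by simp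
qed

text \<open>The value of \<open>excursion 0\<close> at \<open>(a, c)\<close> is positive only if \<open>c\<close> or its rotate by \<open>\<surd>2\<close> lies in \<open>spikes\<close>, which has
  probability at most twice \<open>1/6\<close>.\<close>

lemma mean_excursion_bounds: "0 \<le> mean_excursion" "mean_excursion \<le> 1 / 3"
proof -
  show "0 \<le> mean_excursion" unfolding mean_excursion_def by (simp add: excursion_bounds)
  define R where "R = (\<lambda>c. frac (c + sqrt 2)) -` spikes \<inter> space circle"
  have [measurable]: "R \<in> sets circle"
    unfolding R_def by (rule measurable_sets[OF _ sets_spikes]) measurable
  \<comment> \<open>Outside this set the visits at both ends of the current unit interval vanish.\<close>
  define S where "S = space circle \<times> (spikes \<union> R)"
  have [measurable]: "S \<in> sets cylinder" unfolding S_def by simp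
  have "mean_excursion \<le> (\<integral>\<omega>. indicator S \<omega> \<partial>cylinder)"
    unfolding mean_excursion_def
  proof (rule integral_mono[OF integrable_excursion])
    fix \<omega> assume \<omega>: "\<omega> \<in> space cylinder"
    show "excursion 0 \<omega> \<le> indicator S \<omega>"
    proof (cases "\<omega> \<in> S")
      case False
      then show ?thesis
        using \<omega> by (auto simp: excursion_0[OF \<omega>] S_def R_def space_pair_measure indicator_def)
    qed (simp add: excursion_bounds)
  qed (rule cylinder.P.integrable_const_bound[where B = 1], auto simp: indicator_def)
  also have "\<dots> = measure cylinder S" by simp
  also have "\<dots> \<le> 1 / 3"
  proof -
    have "emeasure cylinder S = emeasure circle (spikes \<union> R)"
      by (simp add: S_def circle.emeasure_pair_measure_Times circle.emeasure_space_1)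
    also have "\<dots> \<le> emeasure circle spikes + emeasure circle R"
      by (rule emeasure_subadditive) auto
    also have "\<dots> \<le> ennreal (1 / 6) + ennreal (1 / 6)"
      using emeasure_spikes_le emeasure_circle_rotation[OF sets_spikes, of "sqrt 2"]
      by (intro add_mono) (auto simp: R_def)
    also have "\<dots> = ennreal (1 / 3)" by (simp flip: ennreal_plus)
    finally have "emeasure cylinder S \<le> ennreal (1 / 3)" .
    then show ?thesis unfolding measure_def by (rule enn2real_leI[rotated]) simp
  qed
  finally show "mean_excursion \<le> 1 / 3" .
qed

text \<open>The solution \<open>x\<close> of \<open>(2 + x) p - x = 0\<close>, where \<open>p\<close> is the mean excursion. It is at most \<open>1\<close> precisely
  when \<open>p \<le> 1/3\<close>.\<close>

definition trough :: real where
  "trough = 2 * mean_excursion / (1 - mean_excursion)"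

lemma trough_bounds: "0 \<le> trough" "trough \<le> 1"
  using mean_excursion_bounds by (auto simp: trough_def field_simps)

definition speed :: "real \<Rightarrow> real \<times> real \<Rightarrow> real" where
  "speed y \<omega> = (2 + trough) * excursion y \<omega> - trough"

lemma speed_bounds: "- 1 \<le> speed y \<omega>" "speed y \<omega> \<le> 2"
proof -
  have low: "0 \<le> (2 + trough) * excursion y \<omega>"
    using excursion_bounds trough_bounds by simp
  show "- 1 \<le> speed y \<omega>"
    unfolding speed_def using low trough_bounds by linarith
  have "(2 + trough) * excursion y \<omega> \<le> 2 + trough"
    using excursion_bounds trough_bounds by (intro mult_left_le) auto
  then show "speed y \<omega> \<le> 2"
    unfolding speed_def by (simp only: diff_le_eq)
qed

lemma speed_C11: "(\<lambda>r. speed r \<omega>) \<in> C11"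
  unfolding speed_def excursion_def by (rule affine_interpolate_C11[OF visits_in_01])

lemma continuous_speed: "continuous_on UNIV (\<lambda>r. speed r \<omega>)"
  using speed_C11[of \<omega>] lipschitz_on_continuous_on by (auto simp: C11_def)

lemma stationary_speed: "stationary cylinder flow speed"
proof -
  have "(\<lambda>(x, \<omega>). speed x \<omega>) = (\<lambda>z. (2 + trough) * (case z of (x, \<omega>) \<Rightarrow> excursion x \<omega>) - trough)"
    by (auto simp: speed_def)
  then have "(\<lambda>(x, \<omega>). speed x \<omega>) \<in> borel_measurable (borel \<Otimes>\<^sub>M cylinder)"
    using measurable_excursion by simp
  then show ?thesis by (simp add: stationary_def speed_def excursion_flow)
qed

lemma integrable_speed: "integrable cylinder (speed x)"
  and integral_speed: "(\<integral>\<omega>. speed x \<omega> \<partial>cylinder) = 0"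
proof -
  show "integrable cylinder (speed x)"
    unfolding speed_def by (intro Bochner_Integration.integrable_diff integrable_mult_right integrable_excursion) simp
  have "(\<integral>\<omega>. speed x \<omega> \<partial>cylinder) = (2 + trough) * mean_excursion - trough"
    unfolding speed_def using integrable_excursion[of x]
    by (simp add: integral_excursion cylinder.P.prob_space)
  also have "\<dots> = 2 * mean_excursion - trough * (1 - mean_excursion)" by (simp add: algebra_simps)
  also have "\<dots> = 0" using mean_excursion_bounds by (simp add: trough_def)
  finally show "(\<integral>\<omega>. speed x \<omega> \<partial>cylinder) = 0" .
qed

lemma AE_speed_small: "AE \<omega> in cylinder. \<exists>r. \<bar>speed r \<omega>\<bar> \<le> 1"
  using AE_visits_zero
proof eventually_elim
  case (elim \<omega>)
  then obtain n where "visits (snd \<omega>) n = 0" by blast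
  then have "speed (of_int n - fst \<omega>) \<omega> = - trough"
    by (simp add: speed_def excursion_def interpolate_of_int)
  then show ?case using trough_bounds by (intro exI[of _ "of_int n - fst \<omega>"]) simp
qed

text \<open>The interpolation at time \<open>r\<close> uses the visits at the two integers enclosing \<open>a + r\<close>, whose absolute values
  are at most \<open>4\<^sup>k\<close>.\<close>

lemma speed_half_tower:
  assumes a: "a \<in> space circle" and c: "c \<in> tower k (4 ^ k)" and r: "\<bar>r\<bar> < 4 ^ k - 1"
  shows "speed r (a, c) = 2"
proof -
  define m where "m = \<lfloor>a + r\<rfloor>"
  have "real_of_int m \<le> a + r" "a + r < real_of_int m + 1"
    by (simp_all add: m_def)
  moreover have "0 \<le> a" "a < 1" "r < 4 ^ k - 1" "- (4 ^ k - 1) < r"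
    using a r by (auto simp: space_circle)
  ultimately have "real_of_int m < 4 ^ k" "- (4 ^ k) < real_of_int m"
    by linarith+
  then have "real_of_int m < real_of_int (4 ^ k)" "real_of_int (- (4 ^ k)) < real_of_int m"
    by (simp_all only: of_int_minus of_int_power of_int_numeral)
  then have "m < 4 ^ k" "- (4 ^ k) < m"
    by (simp_all only: of_int_less_iff)
  then have "visits c m = 1" "visits c (m + 1) = 1"
    by (auto intro!: visits_half_tower[OF c])
  then show ?thesis by (simp add: speed_def excursion_def interpolate_def m_def)
qed

lemma min_radius_half_tower:
  assumes a: "a \<in> space circle" and c: "c \<in> tower k (4 ^ k)" and ex: "\<bar>speed r (a, c)\<bar> \<le> 1"
  shows "4 ^ k - 1 \<le> min_radius (\<lambda>r. speed r (a, c))"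
proof -
  have "min_radius (\<lambda>r. speed r (a, c)) \<in> small_radii (\<lambda>r. speed r (a, c))"
    by (rule min_radius_attained(1)[OF continuous_speed ex])
  then obtain s where s: "min_radius (\<lambda>r. speed r (a, c)) = \<bar>s\<bar>" "\<bar>speed s (a, c)\<bar> \<le> 1"
    by (auto simp: small_radii_def)
  then show ?thesis using speed_half_tower[OF a c, of s] by force
qed

text \<open>The half towers of index \<open>k\<close> alone contribute \<open>(4\<^sup>k - 1) (2 \<sqdot> 4\<^sup>k + 1) / (60 \<sqdot> 8\<^sup>k)\<close>, which grows like \<open>2\<^sup>k\<close>.\<close>

lemma nn_integral_min_radius:
  "(\<integral>\<^sup>+\<omega>. ennreal (min_radius (\<lambda>r. speed r \<omega>)) \<partial>cylinder) = \<infinity>" (is "?I = \<infinity>")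
proof -
  have lower: "ennreal ((2 ^ k - 1) / 30) \<le> ?I" for k
  proof -
    let ?T = "space circle \<times> tower k (4 ^ k)"
    \<comment> \<open>In terms of \<open>2\<^sup>k\<close> the estimate below is the polynomial inequality \<open>2u\<^sup>3 \<le> (u + 1)(2u\<^sup>2 + 1)\<close>.\<close>
    define u :: real where "u = 2 ^ k"
    have u: "1 \<le> u" and u4: "(4 :: real) ^ k = u * u" and u8: "(8 :: real) ^ k = u * u * u"
      by (simp_all add: u_def flip: power_mult_distrib)
    have "(u - 1) / 30 = ((u - 1) * (2 * (u * u * u))) / (60 * (u * u * u))"
      using u by simp
    also have "\<dots> \<le> ((u - 1) * ((u + 1) * (2 * (u * u) + 1))) / (60 * (u * u * u))"
      using u by (intro divide_right_mono mult_left_mono) (auto simp: algebra_simps)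
    also have "\<dots> = (4 ^ k - 1) * ((2 * 4 ^ k + 1) / (60 * 8 ^ k))"
      unfolding u4 u8 by (simp add: algebra_simps)
    finally have bound: "(2 ^ k - 1) / 30 \<le> (4 ^ k - 1) * ((2 * 4 ^ k + 1) / (60 * 8 ^ k) :: real)"
      by (simp add: u_def)
    have one: "(1 :: real) \<le> 4 ^ k" by simp
    have "ennreal ((2 ^ k - 1) / 30) \<le> ennreal ((4 ^ k - 1) * ((2 * 4 ^ k + 1) / (60 * 8 ^ k)))"
      using bound by (rule ennreal_leI)
    also have "\<dots> = ennreal (4 ^ k - 1) * ennreal ((2 * 4 ^ k + 1) / (60 * 8 ^ k))"
      using one by (intro ennreal_mult) auto
    also have "\<dots> = ennreal (4 ^ k - 1) * emeasure cylinder ?T"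
      by (simp add: circle.emeasure_pair_measure_Times circle.emeasure_space_1 emeasure_half_tower)
    also have "\<dots> = (\<integral>\<^sup>+\<omega>. ennreal (4 ^ k - 1) * indicator ?T \<omega> \<partial>cylinder)"
      by (rule nn_integral_cmult_indicator[symmetric]) simp
    also have "\<dots> \<le> ?I"
    proof (rule nn_integral_mono_AE)
      show "AE \<omega> in cylinder. ennreal (4 ^ k - 1) * indicator ?T \<omega> \<le> ennreal (min_radius (\<lambda>r. speed r \<omega>))"
        using AE_speed_small
      proof eventually_elim
        case (elim \<omega>)
        then obtain r where "\<bar>speed r \<omega>\<bar> \<le> 1" by blast
        then show ?case
          using min_radius_half_tower[of "fst \<omega>" "snd \<omega>" k r]
          by (cases \<omega>) (auto simp: indicator_def intro: ennreal_leI)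
      qed
    qed
    finally show ?thesis .
  qed
  have "of_nat n \<le> ?I" for n
  proof -
    have "30 * n + 1 \<le> 2 ^ (30 * n)" by (simp add: Suc_leI)
    then have "real (30 * n + 1) \<le> real (2 ^ (30 * n))" by (simp only: of_nat_le_iff)
    then have "real n \<le> (2 ^ (30 * n) - 1) / 30" by simp
    then have "ennreal (real n) \<le> ennreal ((2 ^ (30 * n) - 1) / 30)" by (rule ennreal_leI)
    also note lower
    finally show ?thesis by (simp add: ennreal_of_nat_eq_real_of_nat)
  qed
  then show ?thesis
    by (metis ennreal_Ex_less_of_nat infinity_ennreal_def less_top not_le)
qed

theorem proposition3p1:
  shows "\<exists>(M :: (real \<times> real) measure) (\<tau> :: real \<Rightarrow> real \<times> real \<Rightarrow> real \<times> real)
           (V\<^sub>2 :: real \<Rightarrow> real \<times> real \<Rightarrow> real).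
     prob_space M \<and>
     ergodic_group M \<tau> \<and>
     stationary M \<tau> V\<^sub>2 \<and>
     (\<forall>x. integrable M (V\<^sub>2 x) \<and> (\<integral>\<omega>. V\<^sub>2 x \<omega> \<partial>M) = 0) \<and>
     (AE \<omega> in M. (\<lambda>r. V\<^sub>2 r \<omega>) \<in> C11) \<and>
     (AE \<omega> in M. sup_norm (\<lambda>r. V\<^sub>2 r \<omega>) \<le> 2) \<and>
     (AE \<omega> in M. min_radius (\<lambda>r. V\<^sub>2 r \<omega>) \<in> small_radii (\<lambda>r. V\<^sub>2 r \<omega>)) \<and>
     (\<integral>\<^sup>+\<omega>. ennreal (min_radius (\<lambda>r. V\<^sub>2 r \<omega>)) \<partial>M) = \<infinity> \<and>
     ((\<integral>\<^sup>+\<omega>. min_time (shear_field V\<^sub>2 \<omega>) 0 (axis 2 1) \<partial>M) = \<infinity> \<or>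
      (\<integral>\<^sup>+\<omega>. min_time (shear_field V\<^sub>2 \<omega>) 0 (- axis 2 1) \<partial>M) = \<infinity>)"
proof -
  have sup: "sup_norm (\<lambda>r. speed r \<omega>) \<le> 2" for \<omega>
    unfolding sup_norm_def
  proof (rule SUP_least)
    fix r
    have "\<bar>speed r \<omega>\<bar> \<le> 2" using speed_bounds[of r \<omega>] by linarith
    then show "ennreal \<bar>speed r \<omega>\<bar> \<le> 2" using ennreal_leI[of _ 2] by simp
  qed
  have attained: "AE \<omega> in cylinder. min_radius (\<lambda>r. speed r \<omega>) \<in> small_radii (\<lambda>r. speed r \<omega>)"
    using AE_speed_small by eventually_elim (blast intro: min_radius_attained(1)[OF continuous_speed])
  have "AE \<omega> in cylinder. ennreal (min_radius (\<lambda>r. speed r \<omega>)) \<le> min_time (shear_field speed \<omega>) 0 (- axis 2 1)"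
    using AE_speed_small
  proof eventually_elim
    case (elim \<omega>)
    then obtain r\<^sub>0 where r\<^sub>0: "\<bar>speed r\<^sub>0 \<omega>\<bar> \<le> 1" by blast
    show ?case
    proof (rule min_time_shear_ge)
      fix r assume "\<bar>r\<bar> < min_radius (\<lambda>r. speed r \<omega>)"
      then have "1 < \<bar>speed r \<omega>\<bar>" by (rule min_radius_attained(2)[OF continuous_speed r\<^sub>0])
      then show "1 < speed r \<omega>" using speed_bounds(1)[of r \<omega>] by linarith
    qed
  qed
  then have "\<infinity> \<le> (\<integral>\<^sup>+\<omega>. min_time (shear_field speed \<omega>) 0 (- axis 2 1) \<partial>cylinder)"
    unfolding nn_integral_min_radius[symmetric] by (rule nn_integral_mono_AE)
  then have time: "(\<integral>\<^sup>+\<omega>. min_time (shear_field speed \<omega>) 0 (- axis 2 1) \<partial>cylinder) = \<infinity>"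
    by (simp add: top_unique)
  show ?thesis
    using cylinder.P.prob_space_axioms ergodic_flow stationary_speed integrable_speed integral_speed
      speed_C11 sup attained nn_integral_min_radius time
    by (intro exI[of _ cylinder] exI[of _ flow] exI[of _ speed]) simp
qed

end
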